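(* Let $(K,\mathcal{K})$ be a directed Euclidean cubical complex in $\mathbb{R}^n$ that has a minimum vertex $w$. Let $(L,\mathcal{L})=\mathrm{reach}(K,w)$. Let $(\tau,\sigma)$ be an LPDC pair in $L$, and let $L'$ be the $(\tau,\sigma)$-collapse of $L$. The spaces of dipaths $\overrightarrow{P}_{w}^{v}(L)$ are connected for all $v\in\mathrm{verts}(L)$ if and only if the spaces of dipaths $\overrightarrow{P}_{w}^{v}(L')$ are connected for all $v\in\mathrm{verts}(L')$.
   Context: Order: for $p,q\in\mathbb{R}^n$, $p\preceq q$ means $p_i\le q_i$ for every $i$, and $[p,q]:=\{x\in\mathbb{R}^n : p\preceq x\preceq q\}$. Cubes: an elementary cube in $\mathbb{R}^n$ is a set $[v-j,v]$ with $v\in\mathbb{Z}^n$, $j\in\{0,1\}^n$; its dimension is $\sum_i j_i$. If $\tau\subseteq\sigma$ are elementary cubes, $\tau$ is a face of $\sigma$ and $\sigma$ is a coface of $\tau$. Complexes: a (directed) Euclidean cubical complex $(K,\mathcal{K})$ in $\mathbb{R}^n$ is a subspace $K\subsetneq\mathbb{R}^n$ that is a finite union of elementary cubes, together with the stratification $\mathcal{K}$ of $K$ whose strata are the relative interiors of the elementary cubes contained in $K$ (a vertex being its own relative interior). For $\sigma\in\mathcal{K}$, $\overline{\sigma}$ is the corresponding closed elementary cube; faces of $\sigma$ refer to $\overline{\sigma}$. $\mathrm{verts}(K)=K\cap\mathbb{Z}^n$ is the set of zero-cubes of $K$. A cube of $K$ is maximal if it has no proper coface in $K$. A minimum vertex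 of $K$ is $w\in\mathrm{verts}(K)$ with $w\preceq x$ for all $x\in K$. Dipaths: a dipath in $K$ is a continuous map $\gamma:[0,1]\to K$ with $\gamma(s)\preceq\gamma(t)$ whenever $s\le t$. $\overrightarrow{P}_p^q(K)$ is the space of dipaths from $p$ to $q$ with the compact-open topology. The reachable complex from $p\in\mathrm{verts}(K)$ is $\mathrm{reach}(K,p):=\{q\in K : \overrightarrow{P}_p^q(K)\neq\emptyset\}$, regarded as a directed Euclidean cubical complex. Past link: for $v\in\mathbb{Z}^n$, $\mathrm{lk}^-_K(v):=\{j\in\{0,1\}^n\setminus\{\mathbf 0\} : [v-j,v]\subseteq K\}$, viewed as an abstract simplicial complex in which $j$ stands for the simplex $\{x_i : j_i=1\}$ on vertices among $x_1,\dots,x_n$. Collapse (in any directed Euclidean cubical complex $K$): $\tau$ is a free face of $\sigma$ if $\sigma$ is a maximal cube, $\tau$ is a proper face of $\sigma$, and no other maximal cube of $K$ contains $\tau$. In that case the $(\tau,\sigma)$-collapse of $K$ is the subcomplex $K'$ obtained from $K$ by removing all (open) cubes $\gamma\in\mathcal{K}$ with $\overline{\tau}\subseteq\overline{\gamma}\subseteq\overline{\sigma}$. The pair $(\tau,\sigma)$ is an LPDC pair in $K$ if $\tau$ is a free face of $\sigma$ and (the geometric realizations of) $\mathrm{lk}^-_K(v)$ and $\mathrm{lk}^-_{K'}(v)$ are homotopy equivalent for all $v\in\mathrm{verts}(K')$. *)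

theory Defs
  imports "HOL-Analysis.Analysis"
begin

text \<open>The order \<^term>\<open>(\<le>)\<close> on \<^typ>\<open>real ^ 'n\<close> is the componentwise (product) order of the library, and
  \<^term>\<open>{p..q}\<close> is the corresponding interval.\<close>

definition lattice_points :: "(real ^ 'n) set" where
  "lattice_points = {v. \<forall>i. v $ i \<in> \<int>}"

definition zero_one_vectors :: "(real ^ 'n) set" where
  "zero_one_vectors = {j. \<forall>i. j $ i \<in> {0, 1}}"

definition elementary_cube :: "(real ^ 'n) set \<Rightarrow> bool" where
  "elementary_cube c \<longleftrightarrow> (\<exists>v\<in>lattice_points. \<exists>j\<in>zero_one_vectors. c = {v - j..v})"

text \<open>A complex is given by its underlying space: the stratification is determined by it. A stratum
  is represented by its closure, a closed elementary cube contained in the space; the stratum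
  itself is the relative interior of that cube.\<close>

definition cubical_complex :: "(real ^ 'n) set \<Rightarrow> bool" where
  "cubical_complex K \<longleftrightarrow>
     K \<noteq> UNIV \<and> (\<exists>C. finite C \<and> (\<forall>c\<in>C. elementary_cube c) \<and> K = \<Union>C)"

definition cubes :: "(real ^ 'n) set \<Rightarrow> (real ^ 'n) set set" where
  "cubes K = {c. elementary_cube c \<and> c \<subseteq> K}"

definition verts :: "(real ^ 'n) set \<Rightarrow> (real ^ 'n) set" where
  "verts K = K \<inter> lattice_points"

definition maximal_cube :: "(real ^ 'n) set \<Rightarrow> (real ^ 'n) set \<Rightarrow> bool" where
  "maximal_cube K c \<longleftrightarrow> c \<in> cubes K \<and> \<not> (\<exists>d\<in>cubes K. c \<subset> d)"

definition minimum_vertex :: "(real ^ 'n) set \<Rightarrow> real ^ 'n \<Rightarrow> bool" where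
  "minimum_vertex K w \<longleftrightarrow> w \<in> verts K \<and> (\<forall>x\<in>K. w \<le> x)"

text \<open>The compact-open topology on the continuous maps from \<^term>\<open>X\<close> to \<^term>\<open>Y\<close>. Maps are
  \<^const>\<open>extensional\<close>, so that functions agreeing on the domain are equal. Taking the empty
  compact set shows that the subbasic sets cover all continuous maps.\<close>

definition compact_open_topology :: "'a topology \<Rightarrow> 'b topology \<Rightarrow> ('a \<Rightarrow> 'b) topology" where
  "compact_open_topology X Y = topology_generated_by
     {{f \<in> extensional (topspace X). continuous_map X Y f \<and> f ` C \<subseteq> U} | C U.
        compactin X C \<and> openin Y U}"

definition dipaths :: "(real ^ 'n) set \<Rightarrow> real ^ 'n \<Rightarrow> real ^ 'n \<Rightarrow> (real \<Rightarrow> real ^ 'n) set" where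
  "dipaths K p q =
     {\<gamma> \<in> extensional {0..1}.
        continuous_map (top_of_set {0..1}) (top_of_set K) \<gamma> \<and>
        (\<forall>s\<in>{0..1}. \<forall>t\<in>{0..1}. s \<le> t \<longrightarrow> \<gamma> s \<le> \<gamma> t) \<and> \<gamma> 0 = p \<and> \<gamma> 1 = q}"

definition dipath_space ::
    "(real ^ 'n) set \<Rightarrow> real ^ 'n \<Rightarrow> real ^ 'n \<Rightarrow> (real \<Rightarrow> real ^ 'n) topology" where
  "dipath_space K p q =
     subtopology (compact_open_topology (top_of_set {0..1}) (top_of_set K)) (dipaths K p q)"

definition reach :: "(real ^ 'n) set \<Rightarrow> real ^ 'n \<Rightarrow> (real ^ 'n) set" where
  "reach K p = {q \<in> K. dipaths K p q \<noteq> {}}"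

text \<open>A 0/1 vector \<open>j\<close> of the past link stands for the simplex of the coordinates \<open>i\<close> with
  \<open>j $ i = 1\<close>.\<close>

definition past_link :: "(real ^ 'n) set \<Rightarrow> real ^ 'n \<Rightarrow> 'n set set" where
  "past_link K v =
     (\<lambda>j. {i. j $ i = 1}) ` {j \<in> zero_one_vectors. j \<noteq> 0 \<and> {v - j..v} \<subseteq> K}"

text \<open>The vertex \<open>x\<^sub>i\<close> is realized as the unit vector \<open>axis i 1\<close>. The empty simplex is not a
  member of a past link, so an empty past link has empty realization.\<close>

definition geometric_realization :: "'n set set \<Rightarrow> (real ^ 'n::finite) set" where
  "geometric_realization \<Delta> = (\<Union>S\<in>\<Delta>. convex hull ((\<lambda>i. axis i 1) ` S))"

definition free_face :: "(real ^ 'n) set \<Rightarrow> (real ^ 'n) set \<Rightarrow> (real ^ 'n) set \<Rightarrow> bool" where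
  "free_face K \<tau> \<sigma> \<longleftrightarrow>
     maximal_cube K \<sigma> \<and> elementary_cube \<tau> \<and> \<tau> \<subset> \<sigma> \<and>
     (\<forall>\<rho>. maximal_cube K \<rho> \<and> \<tau> \<subseteq> \<rho> \<longrightarrow> \<rho> = \<sigma>)"

definition collapse :: "(real ^ 'n) set \<Rightarrow> (real ^ 'n) set \<Rightarrow> (real ^ 'n) set \<Rightarrow> (real ^ 'n) set" where
  "collapse K \<tau> \<sigma> = K - (\<Union>c\<in>{c \<in> cubes K. \<tau> \<subseteq> c \<and> c \<subseteq> \<sigma>}. rel_interior c)"

definition lpdc_pair :: "(real ^ 'n) set \<Rightarrow> (real ^ 'n) set \<Rightarrow> (real ^ 'n) set \<Rightarrow> bool" where
  "lpdc_pair K \<tau> \<sigma> \<longleftrightarrow>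
     free_face K \<tau> \<sigma> \<and>
     (\<forall>v\<in>verts (collapse K \<tau> \<sigma>).
        geometric_realization (past_link K v) homotopy_eqv
        geometric_realization (past_link (collapse K \<tau> \<sigma>) v))"

end

theory Submission
  imports Defs
begin

text \<open>For a cubical set with minimum vertex \<open>w\<close> all of whose other vertices have nonempty past
  links, the dipath spaces from \<open>w\<close> to all vertices are connected if and only if the past links of all
  vertices other than \<open>w\<close> are connected. If the past link of \<open>v\<close> splits, then the dipaths to \<open>v\<close>
  split into two open sets according to the part through which they arrive. Conversely, by induction
  on \<open>v\<close>: stretching each coordinate within its unit intervals deforms any dipath to \<open>v\<close> into one
  that arrives along an edge, and a square ending at \<open>v\<close> connects the dipaths arriving along its
  two edges at \<open>v\<close>.

  An LPDC collapse preserves emptiness and connectedness of the past links of the remaining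
  vertices, and the past link of a vertex that it removes is a full simplex.\<close>

section \<open>Carrier cubes\<close>

text \<open>The work is done with the smallest elementary cube around each point. If
  \<open>h x\<close> lies in this cube for every \<open>x\<close>, then \<open>h\<close> maps every
  cubical set into itself, fixes lattice points, and is joined to the identity by segments that stay
  in the set. If \<open>h\<close> is moreover continuous and monotone, the straight-line homotopy
  from a dipath to its image runs through dipaths, since convex combinations of monotone paths are
  monotone. The obstacle is that a dipath may arrive at \<open>v\<close> through the interior of a
  large cube and touch no edge at \<open>v\<close>. A map \<open>h\<close> as above is therefore
  adapted to one point of the dipath close to \<open>v\<close>, so that this point lands on the
  lower end of an edge. A second difficulty is that the collapse is not given as a set of reachable
  points, and removing cubes may destroy dipaths. Dipaths to its vertices are recovered from its
  past links: where these are nonempty, one can walk back along edges, and the walk stops only at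
  \<open>w\<close>.\<close>

definition carrier :: "real ^ 'n \<Rightarrow> (real ^ 'n) set" where
  "carrier x = {y. \<forall>i. \<lfloor>x $ i\<rfloor> \<le> y $ i \<and> y $ i \<le> \<lceil>x $ i\<rceil>}"

definition vfloor :: "real ^ 'n \<Rightarrow> real ^ 'n" where
  "vfloor x = (\<chi> i. of_int \<lfloor>x $ i\<rfloor>)"

definition vceiling :: "real ^ 'n \<Rightarrow> real ^ 'n" where
  "vceiling x = (\<chi> i. of_int \<lceil>x $ i\<rceil>)"

text \<open>Turns a simplex of the past link back into the vector \<open>j\<close> that it stands
  for.\<close>

definition simplex_vec :: "'n set \<Rightarrow> real ^ 'n" where
  "simplex_vec S = (\<chi> i. indicator S i)"

lemma carrier_eq_interval: "carrier x = {vfloor x..vceiling x}"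
  by (auto simp: carrier_def vfloor_def vceiling_def less_eq_vec_def)

lemma carrierD:
  "y \<in> carrier x \<Longrightarrow> \<lfloor>x $ i\<rfloor> \<le> y $ i" "y \<in> carrier x \<Longrightarrow> y $ i \<le> \<lceil>x $ i\<rceil>"
  by (auto simp: carrier_def)

lemma mem_carrier [simp]: "x \<in> carrier x"
  by (simp add: carrier_def)

lemma convex_carrier: "convex (carrier x)"
  unfolding carrier_eq_interval interval_cbox by (rule convex_box)

text \<open>An integer bound on a real number is also a bound on its floor and ceiling.\<close>

lemma carrier_mono: "y \<in> carrier x \<Longrightarrow> carrier y \<subseteq> carrier x"
  unfolding carrier_def
  by (smt (verit, ccfv_threshold) ceiling_le le_floor_iff mem_Collect_eq of_int_le_iff subsetI)

lemma closed_segment_subset_carrier: "y \<in> carrier x \<Longrightarrow> closed_segment x y \<subseteq> carrier x"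
  by (simp add: closed_segment_subset convex_carrier)

lemma lattice_pointsD: "v \<in> lattice_points \<Longrightarrow> of_int \<lfloor>v $ i\<rfloor> = v $ i"
  "v \<in> lattice_points \<Longrightarrow> of_int \<lceil>v $ i\<rceil> = v $ i"
  by (auto simp: lattice_points_def elim!: Ints_cases)

lemma carrier_lattice_point: "v \<in> lattice_points \<Longrightarrow> carrier v = {v}"
  by (auto simp: carrier_def lattice_pointsD vec_eq_iff order_antisym)

lemma vceiling_lattice: "vceiling x \<in> lattice_points"
  by (auto simp: lattice_points_def vceiling_def)

lemma vfloor_in_carrier: "vfloor x \<in> carrier x"
  by (auto simp: carrier_def vfloor_def)

lemma vceiling_in_carrier: "vceiling x \<in> carrier x"
  by (auto simp: carrier_def vceiling_def)

lemma elementary_cube_carrier: "elementary_cube (carrier x)"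
proof -
  have "vceiling x - vfloor x \<in> zero_one_vectors"
    by (auto simp: zero_one_vectors_def vceiling_def vfloor_def ceiling_altdef)
  moreover have "carrier x = {vceiling x - (vceiling x - vfloor x)..vceiling x}"
    by (simp add: carrier_eq_interval)
  ultimately show ?thesis
    unfolding elementary_cube_def using vceiling_lattice by blast
qed

text \<open>The witness is the centre of the cube: its coordinates are half-integers where
  \<open>j\<close> is 1 and integers elsewhere, so rounding recovers both extreme corners.\<close>

lemma interval_eq_carrier:
  assumes "v \<in> lattice_points" "j \<in> zero_one_vectors"
  shows "{v - j..v} = carrier (v - (1/2) *\<^sub>R j)"
proof -
  have "vfloor (v - (1/2) *\<^sub>R j) = v - j \<and> vceiling (v - (1/2) *\<^sub>R j) = v"
  proof -
    have "of_int \<lfloor>v $ i - j $ i / 2\<rfloor> = v $ i - j $ i \<and> of_int \<lceil>v $ i - j $ i / 2\<rceil> = v $ i" for i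
    proof -
      obtain m :: int where m: "v $ i = of_int m"
        using assms(1) by (auto simp: lattice_points_def elim!: Ints_cases)
      have "\<lfloor>of_int m - 1 / 2 :: real\<rfloor> = m - 1" "\<lceil>of_int m - 1 / 2 :: real\<rceil> = m"
        by linarith+
      moreover have "j $ i = 0 \<or> j $ i = 1"
        using assms(2) by (auto simp: zero_one_vectors_def)
      ultimately show ?thesis
        using m by auto
    qed
    then show ?thesis
      by (simp add: vfloor_def vceiling_def vec_eq_iff)
  qed
  then show ?thesis
    by (simp add: carrier_eq_interval)
qed

lemma elementary_cube_iff: "elementary_cube c \<longleftrightarrow> (\<exists>x. c = carrier x)"
  using elementary_cube_carrier interval_eq_carrier unfolding elementary_cube_def by metis

lemma simplex_vec_zero_one: "simplex_vec S \<in> zero_one_vectors"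
  by (auto simp: simplex_vec_def zero_one_vectors_def indicator_def)

lemma simplex_vec_singleton: "simplex_vec {i} = axis i 1"
  by (auto simp: simplex_vec_def vec_eq_iff axis_def)

text \<open>Open cubes are thus the classes of points with equal carrier, which makes removing open
  cubes a condition on the carrier of a point.\<close>

lemma rel_interior_carrier:
  fixes x y :: "real ^ 'n"
  shows "y \<in> rel_interior (carrier x) \<longleftrightarrow> carrier y = carrier x"
proof
  assume y: "y \<in> rel_interior (carrier x)"
  have yx: "y \<in> carrier x"
    using y rel_interior_subset by blast
  have *: "\<exists>e>1. (1 - e) *\<^sub>R z + e *\<^sub>R y \<in> carrier x" if "z \<in> carrier x" for z
    using bspec[OF convex_rel_interior_if[OF convex_carrier y] hull_inc[OF that]]
    by (meson order_refl)
  \<comment> \<open>In a convex set, a segment ending at a relative interior point can be prolonged.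
    Prolonging from the least vertex keeps \<open>y\<close> off the upper faces, prolonging from the
    greatest vertex keeps it off the lower ones.\<close>
  obtain e where e: "e > 1" "(1 - e) *\<^sub>R vfloor x + e *\<^sub>R y \<in> carrier x"
    using *[OF vfloor_in_carrier] by auto
  obtain d where d: "d > 1" "(1 - d) *\<^sub>R vceiling x + d *\<^sub>R y \<in> carrier x"
    using *[OF vceiling_in_carrier] by auto
  have "\<lfloor>y $ i\<rfloor> = \<lfloor>x $ i\<rfloor> \<and> \<lceil>y $ i\<rceil> = \<lceil>x $ i\<rceil>" for i
  proof (cases "\<lfloor>x $ i\<rfloor> = \<lceil>x $ i\<rceil>")
    case True
    then have "y $ i = of_int \<lfloor>x $ i\<rfloor>"
      using carrierD[OF yx, of i] by simp
    then show ?thesis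
      using True by simp
  next
    case False
    then have fc: "\<lceil>x $ i\<rceil> = \<lfloor>x $ i\<rfloor> + 1"
      by (simp add: ceiling_altdef split: if_splits)
    let ?m = "real_of_int \<lfloor>x $ i\<rfloor>"
    have r: "?m \<le> y $ i" "y $ i \<le> ?m + 1"
      using carrierD[OF yx, of i] fc by auto
    have "y $ i \<noteq> ?m + 1"
    proof
      assume "y $ i = ?m + 1"
      moreover have "(1 - e) * ?m + e * y $ i \<le> ?m + 1"
        using carrierD(2)[OF e(2), of i] fc by (simp add: vfloor_def)
      ultimately show False using e(1) by (simp add: algebra_simps)
    qed
    moreover have "y $ i \<noteq> ?m"
    proof
      assume "y $ i = ?m"
      moreover have "?m \<le> (1 - d) * (?m + 1) + d * y $ i"
        using carrierD(1)[OF d(2), of i] fc by (simp add: vceiling_def)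
      ultimately show False using d(1) by (simp add: algebra_simps)
    qed
    ultimately have "?m < y $ i" "y $ i < ?m + 1"
      using r by auto
    then show ?thesis
      unfolding fc by linarith
  qed
  then show "carrier y = carrier x"
    by (simp add: carrier_def)
next
  assume eq: "carrier y = carrier x"
  \<comment> \<open>\<open>T\<close> is an open neighbourhood of \<open>y\<close> that controls the
    non-integer coordinates; \<open>H\<close> is an affine set containing the carrier that freezes
    the integer ones. Together they confine a point to the carrier.\<close>
  define T where "T = {z :: real ^ 'n. \<forall>i. y $ i \<notin> \<int> \<longrightarrow> \<lfloor>y $ i\<rfloor> < z $ i \<and> z $ i < \<lceil>y $ i\<rceil>}"
  define H where "H = {z :: real ^ 'n. \<forall>i. y $ i \<in> \<int> \<longrightarrow> z $ i = y $ i}"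
  have "T = (\<Inter>i\<in>{i. y $ i \<notin> \<int>}. {z :: real ^ 'n. \<lfloor>y $ i\<rfloor> < z $ i} \<inter> {z. z $ i < \<lceil>y $ i\<rceil>})"
    by (auto simp: T_def)
  also have "open \<dots>"
    by (intro open_INT open_Int ballI open_Collect_less continuous_intros) auto
  finally have "open T" .
  have "y \<in> T"
    unfolding T_def mem_Collect_eq
    by (metis Ints_of_int of_int_floor_le le_of_int_ceiling order_le_less)
  have "affine H"
    by (auto simp: H_def affine_def simp flip: distrib_right)
  moreover have "carrier y \<subseteq> H"
    by (auto simp: carrier_def H_def intro!: order_antisym elim!: Ints_cases)
      (metis ceiling_of_int floor_of_int)+
  ultimately have "affine hull (carrier y) \<subseteq> H"
    by (simp add: hull_minimal)
  moreover have "T \<inter> H \<subseteq> carrier y"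
  proof
    fix z assume z: "z \<in> T \<inter> H"
    have "\<lfloor>y $ i\<rfloor> \<le> z $ i \<and> z $ i \<le> \<lceil>y $ i\<rceil>" for i
      using z by (cases "y $ i \<in> \<int>") (force simp: T_def H_def less_imp_le)+
    then show "z \<in> carrier y"
      by (simp add: carrier_def)
  qed
  ultimately show "y \<in> rel_interior (carrier x)"
    unfolding eq[symmetric] mem_rel_interior using \<open>open T\<close> \<open>y \<in> T\<close> mem_carrier by blast
qed

lemma carrier_nontrivial_coordinates:
  "\<lfloor>x $ i\<rfloor> \<noteq> \<lceil>x $ i\<rceil> \<longleftrightarrow> (\<exists>y\<in>carrier x. \<exists>z\<in>carrier x. y $ i \<noteq> z $ i)"
proof
  assume "\<lfloor>x $ i\<rfloor> \<noteq> \<lceil>x $ i\<rceil>"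
  then show "\<exists>y\<in>carrier x. \<exists>z\<in>carrier x. y $ i \<noteq> z $ i"
    by (metis vfloor_in_carrier vceiling_in_carrier of_int_eq_iff vec_lambda_beta vfloor_def
        vceiling_def)
next
  assume "\<exists>y\<in>carrier x. \<exists>z\<in>carrier x. y $ i \<noteq> z $ i"
  then show "\<lfloor>x $ i\<rfloor> \<noteq> \<lceil>x $ i\<rceil>"
    by (force simp: carrier_def dest: spec[of _ i])
qed

section \<open>Dimension and maximal cubes\<close>

definition cube_dim :: "(real ^ 'n) set \<Rightarrow> nat" where
  "cube_dim c = card {i. \<exists>y\<in>c. \<exists>z\<in>c. y $ i \<noteq> z $ i}"

text \<open>Nested cubes have nested integer intervals of length at most 1 in each coordinate. If
  the same coordinates varied on both cubes, all these intervals would agree.\<close>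

lemma cube_dim_strict_mono:
  fixes c d :: "(real ^ 'n) set"
  assumes "elementary_cube c" "elementary_cube d" "c \<subset> d"
  shows "cube_dim c < cube_dim d"
proof -
  obtain x y where x: "c = carrier x" and y: "d = carrier y"
    using assms by (auto simp: elementary_cube_iff)
  let ?D = "\<lambda>c::(real ^ 'n) set. {i. \<exists>y\<in>c. \<exists>z\<in>c. y $ i \<noteq> z $ i}"
  have "?D c \<subseteq> ?D d"
    using assms(3) by blast
  moreover have "?D c \<noteq> ?D d"
  proof
    assume D: "?D c = ?D d"
    have "x \<in> carrier y"
      using assms(3) x y by auto
    have "\<lfloor>y $ i\<rfloor> = \<lfloor>x $ i\<rfloor> \<and> \<lceil>y $ i\<rceil> = \<lceil>x $ i\<rceil>" for i
    proof -
      have "\<lfloor>y $ i\<rfloor> \<le> x $ i" "x $ i \<le> \<lceil>y $ i\<rceil>"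
        using \<open>x \<in> carrier y\<close> by (auto simp: carrier_def)
      then have "\<lfloor>y $ i\<rfloor> \<le> \<lfloor>x $ i\<rfloor>" "\<lceil>x $ i\<rceil> \<le> \<lceil>y $ i\<rceil>"
        by (auto simp: le_floor_iff ceiling_le_iff)
      moreover have "\<lfloor>y $ i\<rfloor> \<noteq> \<lceil>y $ i\<rceil> \<longleftrightarrow> \<lfloor>x $ i\<rfloor> \<noteq> \<lceil>x $ i\<rceil>"
        using D unfolding carrier_nontrivial_coordinates x y by blast
      ultimately show ?thesis
        by (simp add: ceiling_altdef split: if_splits)
    qed
    then have "carrier x = carrier y"
      by (simp add: carrier_def)
    then show False
      using assms(3) x y by simp
  qed
  ultimately have "?D c \<subset> ?D d"
    by blast
  then show ?thesis
    unfolding cube_dim_def by (intro psubset_card_mono) auto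
qed

text \<open>Dimension is bounded by the number of coordinates, so some cube above \<open>c\<close>
  has greatest dimension; by strict monotonicity it is maximal.\<close>

lemma exists_maximal_cube:
  fixes K :: "(real ^ 'n) set"
  assumes "c \<in> cubes K"
  shows "\<exists>d. maximal_cube K d \<and> c \<subseteq> d"
proof -
  have "cube_dim d \<le> CARD('n)" for d :: "(real ^ 'n) set"
    unfolding cube_dim_def by (rule card_mono) auto
  then obtain d where d: "d \<in> cubes K" "c \<subseteq> d"
    and max: "\<And>e. e \<in> cubes K \<Longrightarrow> c \<subseteq> e \<Longrightarrow> cube_dim e \<le> cube_dim d"
    using ex_has_greatest_nat[of "\<lambda>d. d \<in> cubes K \<and> c \<subseteq> d" c cube_dim "Suc CARD('n)"] assms
    by (auto simp: less_Suc_eq_le)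
  have "\<not> d \<subset> e" if "e \<in> cubes K" for e
    using max[OF that] d that cube_dim_strict_mono[of d e] by (force simp: cubes_def)
  then show ?thesis
    using d by (auto simp: maximal_cube_def)
qed

section \<open>Past links and cubes just below a lattice point\<close>

lemma past_link_iff:
  "S \<in> past_link M v \<longleftrightarrow> S \<noteq> {} \<and> {v - simplex_vec S..v} \<subseteq> M"
proof
  assume "S \<in> past_link M v"
  then obtain j where j: "j \<in> zero_one_vectors" "j \<noteq> 0" "{v - j..v} \<subseteq> M" "S = {i. j $ i = 1}"
    by (auto simp: past_link_def)
  then have "simplex_vec S = j"
    by (auto simp: simplex_vec_def zero_one_vectors_def vec_eq_iff indicator_def)
  moreover have "S \<noteq> {}"
    using j(1,2,4) by (auto simp: zero_one_vectors_def vec_eq_iff)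
  ultimately show "S \<noteq> {} \<and> {v - simplex_vec S..v} \<subseteq> M"
    using j by simp
next
  assume S: "S \<noteq> {} \<and> {v - simplex_vec S..v} \<subseteq> M"
  moreover have "S = {i. simplex_vec S $ i = 1}"
    by (auto simp: simplex_vec_def indicator_def)
  moreover have "simplex_vec S \<noteq> 0"
    using S by (auto simp: simplex_vec_def vec_eq_iff indicator_def)
  ultimately show "S \<in> past_link M v"
    unfolding past_link_def using simplex_vec_zero_one by blast
qed

lemma past_link_subset:
  assumes "S \<in> past_link M v" "T \<subseteq> S" "T \<noteq> {}"
  shows "T \<in> past_link M v"
proof -
  have "simplex_vec T \<le> simplex_vec S"
    using assms(2) by (auto simp: simplex_vec_def less_eq_vec_def indicator_def)
  then have "{v - simplex_vec T..v} \<subseteq> {v - simplex_vec S..v}"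
    by (simp add: diff_left_mono)
  then show ?thesis
    using assms unfolding past_link_iff by blast
qed

lemma floor_ceiling_near_lattice_point:
  assumes "v \<in> lattice_points" "v $ i - 1 < x $ i" "x $ i \<le> v $ i"
  shows "of_int \<lfloor>x $ i\<rfloor> = (if x $ i = v $ i then v $ i else v $ i - 1)"
    and "of_int \<lceil>x $ i\<rceil> = v $ i"
proof -
  obtain m :: int where m: "v $ i = of_int m"
    using assms(1) by (auto simp: lattice_points_def elim!: Ints_cases)
  have "\<lceil>x $ i\<rceil> = m" "x $ i \<noteq> v $ i \<Longrightarrow> \<lfloor>x $ i\<rfloor> = m - 1"
    using assms(2,3) m by linarith+
  then show "of_int \<lfloor>x $ i\<rfloor> = (if x $ i = v $ i then v $ i else v $ i - 1)"
    "of_int \<lceil>x $ i\<rceil> = v $ i"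
    using m by auto
qed

lemma carrier_near_lattice_point:
  assumes "v \<in> lattice_points" "\<And>i. v $ i - 1 < x $ i" "x \<le> v"
  shows "carrier x = {v - simplex_vec {i. x $ i \<noteq> v $ i}..v}"
  using floor_ceiling_near_lattice_point[OF assms(1,2)] assms(3)
  by (simp add: carrier_eq_interval vfloor_def vceiling_def simplex_vec_def vec_eq_iff minus_vec_def
      less_eq_vec_def)

section \<open>Connected realizations\<close>

text \<open>Combinatorial connectedness: no vertex set \<open>A\<close> separates the complex. It
  holds for the empty complex, in line with the empty set being connected.\<close>

definition link_indecomposable :: "'n set set \<Rightarrow> bool" where
  "link_indecomposable \<Delta> \<longleftrightarrow>
     (\<forall>A. (\<forall>S\<in>\<Delta>. S \<subseteq> A \<or> S \<inter> A = {}) \<longrightarrow> (\<forall>S\<in>\<Delta>. S \<subseteq> A) \<or> (\<forall>S\<in>\<Delta>. S \<inter> A = {}))"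

lemma geometric_realization_nonempty:
  "{} \<notin> \<Delta> \<Longrightarrow> geometric_realization \<Delta> = {} \<longleftrightarrow> \<Delta> = {}"
  by (auto simp: geometric_realization_def)

text \<open>As the vertices are unit vectors, ambient coordinates are barycentric coordinates:
  nonnegative, supported on \<open>S\<close>, with sum 1.\<close>

lemma simplex_coordinates:
  fixes S :: "'n::finite set"
  assumes "x \<in> convex hull ((\<lambda>i. axis i 1 :: real ^ 'n) ` S)"
  shows "0 \<le> x $ i" "i \<notin> S \<Longrightarrow> x $ i = 0" "\<exists>i\<in>S. 0 < x $ i"
proof -
  let ?C = "{x :: real ^ 'n. (\<forall>i. 0 \<le> x $ i) \<and> (\<forall>i. i \<notin> S \<longrightarrow> x $ i = 0) \<and> (\<Sum>i\<in>UNIV. x $ i) = 1}"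
  have "convex ?C"
    by (auto simp: convex_def sum.distrib simp flip: sum_distrib_left)
  moreover have "(\<lambda>i. axis i 1) ` S \<subseteq> ?C"
    by (auto simp: axis_def)
  ultimately have x: "x \<in> ?C"
    using assms hull_minimal[of _ ?C convex] by blast
  then show "0 \<le> x $ i" "i \<notin> S \<Longrightarrow> x $ i = 0"
    by auto
  show "\<exists>i\<in>S. 0 < x $ i"
  proof (rule ccontr)
    assume "\<not> ?thesis"
    with x have "x $ i = 0" for i
      by (metis (mono_tags, lifting) mem_Collect_eq order_le_less)
    with x show False
      by simp
  qed
qed

lemma connected_geometric_realization_iff:
  fixes \<Delta> :: "'n::finite set set"
  assumes "{} \<notin> \<Delta>"
  shows "connected (geometric_realization \<Delta>) \<longleftrightarrow> link_indecomposable \<Delta>"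
proof
  let ?R = "geometric_realization \<Delta>"
  assume conn: "connected ?R"
  show "link_indecomposable \<Delta>"
    unfolding link_indecomposable_def
  proof (intro allI impI, rule ccontr)
    fix A assume A: "\<forall>S\<in>\<Delta>. S \<subseteq> A \<or> S \<inter> A = {}"
      and "\<not> ((\<forall>S\<in>\<Delta>. S \<subseteq> A) \<or> (\<forall>S\<in>\<Delta>. S \<inter> A = {}))"
    then obtain S T i k where ST: "S \<in> \<Delta>" "T \<in> \<Delta>" "i \<in> S" "i \<notin> A" "k \<in> T" "k \<in> A"
      by blast
    \<comment> \<open>Points with a positive barycentric coordinate at some vertex of
      \<open>B\<close>. A point in both \<open>U A\<close> and \<open>U (- A)\<close> would lie in a
      simplex that meets \<open>A\<close> and its complement.\<close>
    define U where "U B = (\<Union>i\<in>B. {x :: real ^ 'n. 0 < x $ i})" for B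
    have "open (U B)" for B
      unfolding U_def by (intro open_UN ballI open_Collect_less continuous_intros)
    moreover have "?R \<subseteq> U A \<union> U (- A)"
      using simplex_coordinates(3) unfolding geometric_realization_def U_def by blast
    moreover have "U A \<inter> U (- A) \<inter> ?R = {}"
    proof (rule ccontr)
      assume "U A \<inter> U (- A) \<inter> ?R \<noteq> {}"
      then obtain x :: "real ^ 'n" and i k P where x:
        "0 < x $ i" "i \<in> A" "0 < x $ k" "k \<notin> A" "P \<in> \<Delta>"
        "x \<in> convex hull ((\<lambda>i. axis i 1) ` P)"
        unfolding geometric_realization_def U_def by blast
      then have "i \<in> P" "k \<in> P"
        using simplex_coordinates(2)[OF x(6)] by force+
      then show False
        using A x by blast
    qed
    moreover have "axis k 1 \<in> U A \<inter> ?R" "axis i 1 \<in> U (- A) \<inter> ?R"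
      using ST by (auto simp: U_def geometric_realization_def intro: hull_inc)
        (metis ComplI axis_nth zero_less_one)+
    ultimately show False
      using connectedD[OF conn, of "U A" "U (- A)"] by blast
  qed
next
  let ?R = "geometric_realization \<Delta>"
  assume ind: "link_indecomposable \<Delta>"
  have hull: "connected (convex hull ((\<lambda>i. axis i 1 :: real ^ 'n) ` S))" for S
    by (simp add: convex_connected)
  show "connected ?R"
  proof (cases "?R = {}")
    case False
    then obtain x :: "real ^ 'n" and S where x: "S \<in> \<Delta>" "x \<in> convex hull ((\<lambda>i. axis i 1) ` S)"
      unfolding geometric_realization_def by blast
    \<comment> \<open>The vertices in the component of \<open>x\<close>. Simplices are connected, so
      none of them straddles this set.\<close>
    define A where "A = {i. connected_component ?R x (axis i 1)}"
    have face: "connected_component ?R y z" if "T \<in> \<Delta>" "y \<in> convex hull ((\<lambda>i. axis i 1) ` T)"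
      "z \<in> convex hull ((\<lambda>i. axis i 1) ` T)" for T y z
      unfolding connected_component_def
      using that hull[of T] by (intro exI[of _ "convex hull ((\<lambda>i. axis i 1) ` T)"])
        (auto simp: geometric_realization_def)
    have "S \<subseteq> A"
      using face[OF x(1) x(2)] by (auto simp: A_def intro: hull_inc)
    have "T \<subseteq> A \<or> T \<inter> A = {}" if "T \<in> \<Delta>" for T
    proof -
      have "connected_component ?R (axis i 1) (axis k 1)" if "i \<in> T" "k \<in> T" for i k
        using face[OF \<open>T \<in> \<Delta>\<close>] that by (auto intro: hull_inc)
      then show ?thesis
        unfolding A_def using connected_component_trans by blast
    qed
    then have all: "T \<subseteq> A" if "T \<in> \<Delta>" for T
      using ind \<open>S \<subseteq> A\<close> x(1) assms that unfolding link_indecomposable_def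
      by (metis inf.absorb1)
    have "connected_component ?R x y" if "y \<in> ?R" for y
    proof -
      obtain T where T: "T \<in> \<Delta>" "y \<in> convex hull ((\<lambda>i. axis i 1) ` T)"
        using \<open>y \<in> ?R\<close> unfolding geometric_realization_def by blast
      then obtain i where "i \<in> T"
        using assms by (metis ex_in_conv)
      then have "connected_component ?R x (axis i 1)" "connected_component ?R (axis i 1) y"
        using all[OF T(1)] face[OF T(1) _ T(2)] by (auto simp: A_def intro: hull_inc)
      then show ?thesis
        by (rule connected_component_trans)
    qed
    then show ?thesis
      unfolding connected_iff_connected_component
      by (metis connected_component_sym connected_component_trans)
  qed simp
qed

text \<open>The track of the homotopy joins each \<open>y\<close> in \<open>T\<close> to
  \<open>f (g y)\<close>, and all points \<open>f (g y)\<close> lie in the connected image of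
  \<open>S\<close> under \<open>f\<close>.\<close>

lemma homotopy_eqv_connectedness_imp:
  fixes S :: "'a::real_normed_vector set" and T :: "'b::real_normed_vector set"
  assumes "S homotopy_eqv T" "connected S"
  shows "connected T"
proof -
  obtain f g where fg: "continuous_map (top_of_set S) (top_of_set T) f"
     "continuous_map (top_of_set T) (top_of_set S) g"
     "homotopic_with (\<lambda>x. True) (top_of_set T) (top_of_set T) (f \<circ> g) id"
    using assms(1) unfolding homotopy_equivalent_space_def by blast
  then obtain h where h:
    "continuous_map (prod_topology (top_of_set {0..1::real}) (top_of_set T)) (top_of_set T) h"
    "\<And>y. h (0, y) = f (g y)" "\<And>y. h (1, y) = y"
    by (auto simp: homotopic_with_def)
  have conth: "continuous_on ({0..1} \<times> T) h" and hT: "h ` ({0..1} \<times> T) \<subseteq> T"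
    using h(1) by (auto simp: image_subset_iff_funcset)
  have fS: "connected (f ` S)" "f ` S \<subseteq> T" and gT: "g ` T \<subseteq> S"
    using fg assms(2) by (auto intro: connected_continuous_image)
  have *: "connected_component T (f (g y)) y" if "y \<in> T" for y
  proof -
    have "connected ((\<lambda>s. h (s, y)) ` {0..1})"
      by (intro connected_continuous_image continuous_on_compose2[OF conth] continuous_intros)
        (use that in auto)
    moreover have "(\<lambda>s. h (s, y)) ` {0..1} \<subseteq> T"
      using hT that by auto
    moreover have "f (g y) \<in> (\<lambda>s. h (s, y)) ` {0..1}" "y \<in> (\<lambda>s. h (s, y)) ` {0..1}"
      using h(2,3)[of y] by (auto intro!: image_eqI[of _ _ 0] image_eqI[of y _ 1])
    ultimately show ?thesis
      unfolding connected_component_def by blast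
  qed
  have "connected_component T y z" if "y \<in> T" "z \<in> T" for y z
  proof -
    have "connected_component T (f (g y)) (f (g z))"
      unfolding connected_component_def using fS gT that by blast
    then show ?thesis
      using *[OF that(1)] *[OF that(2)] by (metis connected_component_sym connected_component_trans)
  qed
  then show ?thesis
    by (simp add: connected_iff_connected_component)
qed

section \<open>Dipaths and dihomotopies\<close>

text \<open>Without the extensionality demanded by \<open>dipaths\<close>, paths can be joined and
  composed freely. The general type makes monotone reparametrizations dipaths in
  \<open>{0..1}\<close>.\<close>

definition is_dipath ::
    "'a::ordered_euclidean_space set \<Rightarrow> 'a \<Rightarrow> 'a \<Rightarrow> (real \<Rightarrow> 'a) \<Rightarrow> bool" where
  "is_dipath M p q \<gamma> \<longleftrightarrow>
     path \<gamma> \<and> path_image \<gamma> \<subseteq> M \<and> mono_on {0..1} \<gamma> \<and> \<gamma> 0 = p \<and> \<gamma> 1 = q"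

definition dihomotopic ::
    "'a::ordered_euclidean_space set \<Rightarrow> 'a \<Rightarrow> 'a \<Rightarrow> (real \<Rightarrow> 'a) \<Rightarrow> (real \<Rightarrow> 'a) \<Rightarrow> bool" where
  "dihomotopic M p q =
     homotopic_with (\<lambda>\<gamma>. mono_on {0..1} \<gamma> \<and> \<gamma> 0 = p \<and> \<gamma> 1 = q) (top_of_set {0..1}) (top_of_set M)"

lemma dipaths_iff: "\<gamma> \<in> dipaths M p q \<longleftrightarrow> \<gamma> \<in> extensional {0..1} \<and> is_dipath M p q \<gamma>"
  unfolding dipaths_def is_dipath_def path_def path_image_def
  by (auto simp: monotone_on_def continuous_map_in_subtopology image_subset_iff_funcset)

lemma is_dipath_cong:
  assumes "\<And>t. t \<in> {0..1} \<Longrightarrow> \<gamma> t = \<delta> t"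
  shows "is_dipath M p q \<gamma> \<longleftrightarrow> is_dipath M p q \<delta>"
proof -
  have "continuous_on {0..1} \<gamma> \<longleftrightarrow> continuous_on {0..1} \<delta>" "\<gamma> ` {0..1} = \<delta> ` {0..1}"
    by (rule continuous_on_cong[OF refl] image_cong[OF refl]; erule assms)+
  with assms show ?thesis
    unfolding is_dipath_def path_def path_image_def monotone_on_def by simp
qed

lemma is_dipath_restrict:
  "is_dipath M p q \<gamma> \<Longrightarrow> restrict \<gamma> {0..1} \<in> dipaths M p q"
  unfolding dipaths_iff by (subst is_dipath_cong[of _ \<gamma>]) auto

lemma is_dipath_ends: "is_dipath M p q \<gamma> \<Longrightarrow> p \<in> M" "is_dipath M p q \<gamma> \<Longrightarrow> q \<in> M"
  unfolding is_dipath_def path_image_def by auto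

lemma is_dipath_in: "is_dipath M p q \<gamma> \<Longrightarrow> t \<in> {0..1} \<Longrightarrow> \<gamma> t \<in> M"
  unfolding is_dipath_def path_image_def by auto

lemma is_dipath_mono: "is_dipath M p q \<gamma> \<Longrightarrow> s \<in> {0..1} \<Longrightarrow> t \<in> {0..1} \<Longrightarrow> s \<le> t \<Longrightarrow> \<gamma> s \<le> \<gamma> t"
  unfolding is_dipath_def by (blast dest: mono_onD)

lemma is_dipath_between: "is_dipath M p q \<gamma> \<Longrightarrow> t \<in> {0..1} \<Longrightarrow> p \<le> \<gamma> t \<and> \<gamma> t \<le> q"
  using is_dipath_mono[of M p q \<gamma> 0 t] is_dipath_mono[of M p q \<gamma> t 1]
  by (auto simp: is_dipath_def)

lemma is_dipath_subset: "is_dipath M p q \<gamma> \<Longrightarrow> \<gamma> ` {0..1} \<subseteq> N \<Longrightarrow> is_dipath N p q \<gamma>"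
  unfolding is_dipath_def path_image_def by auto

lemma is_dipath_linepath:
  assumes "a \<le> b" "{a..b} \<subseteq> M"
  shows "is_dipath M a b (linepath a b)"
proof -
  have eq: "linepath a b t = a + t *\<^sub>R (b - a)" for t
    by (simp add: linepath_def algebra_simps)
  have "mono_on {0..1} (linepath a b)"
    unfolding eq using assms(1) by (intro mono_onI) (simp add: scaleR_right_mono)
  moreover have "path_image (linepath a b) \<subseteq> {a..b}"
    using assms(1) closed_segment_subset[of a "{a..b}" b] convex_box(1)[of a b]
    by (simp flip: interval_cbox)
  ultimately show ?thesis
    using assms(2) by (auto simp: is_dipath_def) (auto simp: linepath_def)
qed

lemma is_dipath_join:
  assumes \<alpha>: "is_dipath M p q \<alpha>" and \<beta>: "is_dipath M q r \<beta>"
  shows "is_dipath M p r (\<alpha> +++ \<beta>)"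
proof -
  have "(\<alpha> +++ \<beta>) s \<le> (\<alpha> +++ \<beta>) t" if st: "s \<in> {0..1}" "t \<in> {0..1}" "s \<le> t" for s t
  proof -
    consider "t \<le> 1/2" | "s \<le> 1/2" "1/2 < t" | "1/2 < s"
      using st by linarith
    then show ?thesis
    proof cases
      case 2
      have "\<alpha> (2 * s) \<le> q" "q \<le> \<beta> (2 * t - 1)"
        using is_dipath_between[OF \<alpha>, of "2 * s"] is_dipath_between[OF \<beta>, of "2 * t - 1"] 2 st
        by auto
      then show ?thesis
        using 2 by (simp add: joinpaths_def)
    next
      case 1
      then show ?thesis
        using is_dipath_mono[OF \<alpha>, of "2 * s" "2 * t"] st by (simp add: joinpaths_def)
    next
      case 3
      then show ?thesis
        using is_dipath_mono[OF \<beta>, of "2 * s - 1" "2 * t - 1"] st by (simp add: joinpaths_def)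
    qed
  qed
  then have "mono_on {0..1} (\<alpha> +++ \<beta>)"
    by (intro mono_onI)
  moreover have "path (\<alpha> +++ \<beta>)" "path_image (\<alpha> +++ \<beta>) \<subseteq> M"
    using \<alpha> \<beta>
    by (auto simp: is_dipath_def pathstart_def pathfinish_def
        dest: path_image_join_subset[THEN subsetD])
  ultimately show ?thesis
    using \<alpha> \<beta> by (auto simp: is_dipath_def joinpaths_def)
qed

lemma is_dipath_compose:
  assumes "is_dipath M p q \<gamma>" "continuous_on UNIV h" "mono h" "h ` M \<subseteq> N"
  shows "is_dipath N (h p) (h q) (h \<circ> \<gamma>)"
proof -
  have "mono_on {0..1} (h \<circ> \<gamma>)"
  proof (rule mono_onI)
    fix s t :: real assume "s \<in> {0..1}" "t \<in> {0..1}" "s \<le> t"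
    then show "(h \<circ> \<gamma>) s \<le> (h \<circ> \<gamma>) t"
      using monoD[OF \<open>mono h\<close> is_dipath_mono[OF assms(1)]] by simp
  qed
  moreover have "path (h \<circ> \<gamma>)"
    using assms(1,2) by (auto simp: is_dipath_def intro: path_continuous_image continuous_on_subset)
  ultimately show ?thesis
    using assms(1,4) by (auto simp: is_dipath_def path_image_compose)
qed

lemma is_dipath_reparam:
  assumes \<gamma>: "is_dipath M p q \<gamma>" and \<phi>: "is_dipath {0..1} a b \<phi>"
  shows "is_dipath M (\<gamma> a) (\<gamma> b) (\<gamma> \<circ> \<phi>)"
proof -
  have \<phi>01: "\<phi> ` {0..1} \<subseteq> {0..1}"
    using \<phi> by (simp add: is_dipath_def path_image_def)
  have "path (\<gamma> \<circ> \<phi>)"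
    using \<gamma> \<phi> \<phi>01 unfolding is_dipath_def path_def
    by (intro continuous_on_compose) (auto intro: continuous_on_subset)
  moreover have "mono_on {0..1} (\<gamma> \<circ> \<phi>)"
  proof (rule mono_onI)
    fix s t :: real assume "s \<in> {0..1}" "t \<in> {0..1}" "s \<le> t"
    then show "(\<gamma> \<circ> \<phi>) s \<le> (\<gamma> \<circ> \<phi>) t"
      using is_dipath_mono[OF \<gamma> _ _ is_dipath_mono[OF \<phi>]] \<phi>01 by (simp add: image_subset_iff)
  qed
  ultimately show ?thesis
    using \<gamma> \<phi> \<phi>01 by (auto simp: is_dipath_def path_image_def)
qed

section \<open>Dihomotopies with fixed ends\<close>

lemma dihomotopic_iff:
  fixes M :: "'a::ordered_euclidean_space set"
  shows
  "dihomotopic M p q \<gamma> \<delta> \<longleftrightarrow>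
     (\<exists>h :: real \<times> real \<Rightarrow> 'a. continuous_on ({0..1} \<times> {0..1}) h \<and> (\<forall>t\<in>{0..1}. h (0, t) = \<gamma> t) \<and>
          (\<forall>t\<in>{0..1}. h (1, t) = \<delta> t) \<and> (\<forall>s\<in>{0..1}. is_dipath M p q (\<lambda>t. h (s, t))))"
  (is "_ \<longleftrightarrow> ?R")
proof -
  have "dihomotopic M p q \<gamma> \<delta> \<longleftrightarrow>
     (\<exists>h :: real \<times> real \<Rightarrow> 'a.
          continuous_map (prod_topology (top_of_set {0..1}) (top_of_set {0..1})) (top_of_set M) h \<and>
          (\<forall>t\<in>topspace (top_of_set {0..1}). h (0, t) = \<gamma> t) \<and>
          (\<forall>t\<in>topspace (top_of_set {0..1}). h (1, t) = \<delta> t) \<and>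
          (\<forall>s\<in>{0..1}. mono_on {0..1} (\<lambda>t. h (s, t)) \<and> h (s, 0) = p \<and> h (s, 1) = q))"
    unfolding dihomotopic_def by (rule homotopic_with) (auto simp: monotone_on_def)
  also have "\<dots> \<longleftrightarrow> ?R"
  proof (intro ex_cong1)
    fix h :: "real \<times> real \<Rightarrow> 'a"
    have "path (\<lambda>t. h (s, t))" if "continuous_on ({0..1} \<times> {0..1}) h" "s \<in> {0..1}" for s
      unfolding path_def using that(2)
      by (intro continuous_on_compose2[OF that(1)] continuous_intros) auto
    then show "(continuous_map (prod_topology (top_of_set {0..1}) (top_of_set {0..1}))
            (top_of_set M) h \<and>
          (\<forall>t\<in>topspace (top_of_set {0..1}). h (0, t) = \<gamma> t) \<and>
          (\<forall>t\<in>topspace (top_of_set {0..1}). h (1, t) = \<delta> t) \<and>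
          (\<forall>s\<in>{0..1}. mono_on {0..1} (\<lambda>t. h (s, t)) \<and> h (s, 0) = p \<and> h (s, 1) = q)) \<longleftrightarrow>
        (continuous_on ({0..1} \<times> {0..1}) h \<and> (\<forall>t\<in>{0..1}. h (0, t) = \<gamma> t) \<and>
          (\<forall>t\<in>{0..1}. h (1, t) = \<delta> t) \<and> (\<forall>s\<in>{0..1}. is_dipath M p q (\<lambda>t. h (s, t))))"
      by (auto simp: is_dipath_def path_image_def image_subset_iff Pi_iff)
  qed
  finally show ?thesis .
qed

lemma dihomotopic_sym: "dihomotopic M p q \<gamma> \<delta> \<Longrightarrow> dihomotopic M p q \<delta> \<gamma>"
  unfolding dihomotopic_def by (rule homotopic_with_symD)

lemma dihomotopic_trans [trans]:
  "dihomotopic M p q \<alpha> \<beta> \<Longrightarrow> dihomotopic M p q \<beta> \<gamma> \<Longrightarrow> dihomotopic M p q \<alpha> \<gamma>"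
  unfolding dihomotopic_def by (rule homotopic_with_trans)

text \<open>Convex combinations of two monotone paths with common ends are monotone with the same
  ends, so only the segments have to be checked to stay in \<open>M\<close>.\<close>

lemma dihomotopic_linear:
  assumes \<gamma>: "is_dipath M p q \<gamma>" and \<delta>: "is_dipath M p q \<delta>"
    and seg: "\<And>t. t \<in> {0..1} \<Longrightarrow> closed_segment (\<gamma> t) (\<delta> t) \<subseteq> M"
  shows "dihomotopic M p q \<gamma> \<delta>"
proof -
  let ?h = "\<lambda>(s::real, t). (1 - s) *\<^sub>R \<gamma> t + s *\<^sub>R \<delta> t"
  have c: "continuous_on {0..1} \<gamma>" "continuous_on {0..1} \<delta>"
    using \<gamma> \<delta> by (auto simp: is_dipath_def path_def)
  have cont: "continuous_on ({0..1} \<times> {0..1}) ?h"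
    unfolding case_prod_unfold
    by (intro continuous_intros continuous_on_compose2[OF c(1)] continuous_on_compose2[OF c(2)]) auto
  moreover have "is_dipath M p q (\<lambda>t. ?h (s, t))" if s: "s \<in> {0..1}" for s
  proof -
    have "path (\<lambda>t. ?h (s, t))"
      unfolding path_def using c by (auto intro!: continuous_intros)
    moreover have "path_image (\<lambda>t. ?h (s, t)) \<subseteq> M"
      using s seg by (fastforce simp: path_image_def closed_segment_def)
    moreover have "mono_on {0..1} (\<lambda>t. ?h (s, t))"
      using s is_dipath_mono[OF \<gamma>] is_dipath_mono[OF \<delta>]
      by (auto intro!: mono_onI add_mono scaleR_left_mono)
    ultimately show ?thesis
      using \<gamma> \<delta> by (auto simp: is_dipath_def simp flip: scaleR_left_distrib)
  qed
  ultimately show ?thesis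
    unfolding dihomotopic_iff by (intro exI[of _ ?h] conjI) simp_all
qed

text \<open>The unit interval is convex, so \<open>\<phi>\<close> is linearly dihomotopic to the
  identity; this dihomotopy is then composed with \<open>\<gamma>\<close>.\<close>

lemma dihomotopic_reparam:
  assumes \<gamma>: "is_dipath M p q \<gamma>" and \<phi>: "is_dipath {0..1} 0 1 \<phi>"
  shows "dihomotopic M p q \<gamma> (\<gamma> \<circ> \<phi>)"
proof -
  have id: "is_dipath {0..1} 0 1 (\<lambda>t::real. t)"
    by (auto simp: is_dipath_def path_def path_image_def intro: mono_onI continuous_intros)
  have "closed_segment t (\<phi> t) \<subseteq> {0..1}" if "t \<in> {0..1}" for t
    using that is_dipath_in[OF \<phi> that] by (simp add: closed_segment_subset)
  then obtain h :: "real \<times> real \<Rightarrow> _" where h: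
      "continuous_on ({0..1} \<times> {0..1}) h" "\<forall>t\<in>{0..1}. h (0, t) = t"
      "\<forall>t\<in>{0..1}. h (1, t) = \<phi> t" "\<forall>s\<in>{0..1}. is_dipath {0..1} 0 1 (\<lambda>t. h (s, t))"
    using dihomotopic_linear[OF id \<phi>] unfolding dihomotopic_iff by blast
  have h01: "h ` ({0..1} \<times> {0..1}) \<subseteq> {0..1}"
    using h(4) is_dipath_in by fastforce
  have "continuous_on ({0..1} \<times> {0..1}) (\<gamma> \<circ> h)"
    using h(1) \<gamma> h01 unfolding is_dipath_def path_def
    by (intro continuous_on_compose) (auto intro: continuous_on_subset)
  moreover have "is_dipath M p q (\<lambda>t. (\<gamma> \<circ> h) (s, t))" if "s \<in> {0..1}" for s
    using is_dipath_reparam[OF \<gamma> h(4)[rule_format, OF that]] \<gamma> by (simp add: is_dipath_def o_def)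
  ultimately show ?thesis
    unfolding dihomotopic_iff using h(2,3) by (intro exI[of _ "\<gamma> \<circ> h"]) auto
qed

lemma dihomotopic_join_left:
  assumes "dihomotopic M p q \<alpha> \<alpha>'" and \<beta>: "is_dipath M q r \<beta>"
  shows "dihomotopic M p r (\<alpha> +++ \<beta>) (\<alpha>' +++ \<beta>)"
proof -
  obtain h :: "real \<times> real \<Rightarrow> _" where h:
      "continuous_on ({0..1} \<times> {0..1}) h" "\<forall>t\<in>{0..1}. h (0, t) = \<alpha> t"
      "\<forall>t\<in>{0..1}. h (1, t) = \<alpha>' t" "\<forall>s\<in>{0..1}. is_dipath M p q (\<lambda>t. h (s, t))"
    using assms(1) unfolding dihomotopic_iff by blast
  let ?k = "\<lambda>z. ((\<lambda>t. h (fst z, t)) +++ \<beta>) (snd z)"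
  have "continuous_on ({0..1} \<times> {0..1})
    (\<lambda>z::real \<times> real. if snd z \<le> 1/2 then h (fst z, 2 * snd z) else \<beta> (2 * snd z - 1))"
  proof (rule continuous_on_cases_le)
    show "continuous_on {z \<in> {0..1} \<times> {0..1}. snd z \<le> 1/2} (\<lambda>z. h (fst z, 2 * snd z))"
      by (intro continuous_on_compose2[OF h(1)] continuous_intros) auto
    have "continuous_on {0..1} \<beta>"
      using \<beta> by (simp add: is_dipath_def path_def)
    then show "continuous_on {z \<in> {0..1::real} \<times> {0..1}. 1/2 \<le> snd z} (\<lambda>z. \<beta> (2 * snd z - 1))"
      by (rule continuous_on_compose2) (auto intro!: continuous_intros)
    show "h (fst z, 2 * snd z) = \<beta> (2 * snd z - 1)" if "z \<in> {0..1} \<times> {0..1}" "snd z = 1/2" for z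
    proof -
      have "is_dipath M p q (\<lambda>t. h (fst z, t))"
        using that(1) h(4) by auto
      then show ?thesis
        using that(2) \<beta> by (auto simp: is_dipath_def mult.commute)
    qed
  qed (intro continuous_intros)
  then have "continuous_on ({0..1} \<times> {0..1}) ?k"
    by (simp add: joinpaths_def)
  moreover have "is_dipath M p r (\<lambda>t. ?k (s, t))" if "s \<in> {0..1}" for s
    using is_dipath_join[OF h(4)[rule_format, OF that] \<beta>] by simp
  ultimately show ?thesis
    unfolding dihomotopic_iff using h(2,3) by (intro exI[of _ ?k]) (auto simp: joinpaths_def)
qed

section \<open>The topology of dipath spaces\<close>

lemma openin_compact_open_topology:
  assumes "compactin X C" "openin Y U"
  shows "openin (compact_open_topology X Y)
    {f \<in> extensional (topspace X). continuous_map X Y f \<and> f ` C \<subseteq> U}"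
  unfolding compact_open_topology_def
  by (rule topology_generated_by_Basis, rule CollectI, intro exI[of _ C] exI[of _ U] conjI refl assms)

lemma topspace_compact_open_topology:
  "topspace (compact_open_topology X Y) = {f \<in> extensional (topspace X). continuous_map X Y f}"
proof
  show "topspace (compact_open_topology X Y) \<subseteq> {f \<in> extensional (topspace X). continuous_map X Y f}"
    unfolding compact_open_topology_def topology_generated_by_topspace by blast
  show "{f \<in> extensional (topspace X). continuous_map X Y f} \<subseteq> topspace (compact_open_topology X Y)"
    using openin_subset[OF openin_compact_open_topology[of X "{}" Y "{}"]] by simp
qed

lemma topspace_dipath_space: "topspace (dipath_space M p q) = dipaths M p q"
  unfolding dipath_space_def topspace_subtopology topspace_compact_open_topology
  by (auto simp: dipaths_def)

text \<open>A single time is a compact set, so the condition is subbasic.\<close>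

lemma openin_dipath_space_eval:
  assumes "t \<in> {0..1}" "open W"
  shows "openin (dipath_space M p q) {\<gamma> \<in> dipaths M p q. \<gamma> t \<in> W}"
proof -
  let ?G = "{f \<in> extensional (topspace (top_of_set {0..1})).
    continuous_map (top_of_set {0..1}) (top_of_set M) f \<and> f ` {t} \<subseteq> M \<inter> W}"
  have "openin (compact_open_topology (top_of_set {0..1}) (top_of_set M)) ?G"
    using assms
    by (intro openin_compact_open_topology) (auto simp: compactin_subtopology openin_open_Int)
  moreover have "\<gamma> t \<in> M" if "\<gamma> \<in> dipaths M p q" for \<gamma>
    using that assms(1) is_dipath_in unfolding dipaths_iff by blast
  then have "{\<gamma> \<in> dipaths M p q. \<gamma> t \<in> W} = ?G \<inter> dipaths M p q"
    by (auto simp: dipaths_def)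
  ultimately show ?thesis
    unfolding dipath_space_def openin_subtopology by blast
qed

text \<open>A dihomotopy is a path in the dipath space, by currying into the compact-open
  topology.\<close>

lemma connected_dipath_space:
  assumes "\<And>\<gamma> \<delta>. is_dipath M p q \<gamma> \<Longrightarrow> is_dipath M p q \<delta> \<Longrightarrow> dihomotopic M p q \<gamma> \<delta>"
  shows "connected_space (dipath_space M p q)"
proof (rule path_connected_imp_connected_space, unfold path_connected_space_def topspace_dipath_space,
    intro ballI)
  fix \<gamma> \<delta> assume \<gamma>: "\<gamma> \<in> dipaths M p q" and \<delta>: "\<delta> \<in> dipaths M p q"
  then obtain h :: "real \<times> real \<Rightarrow> _" where h:
      "continuous_on ({0..1} \<times> {0..1}) h" "\<forall>t\<in>{0..1}. h (0, t) = \<gamma> t"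
      "\<forall>t\<in>{0..1}. h (1, t) = \<delta> t" "\<forall>s\<in>{0..1}. is_dipath M p q (\<lambda>t. h (s, t))"
    using assms unfolding dihomotopic_iff dipaths_iff by blast
  let ?g = "\<lambda>s. restrict (\<lambda>t. h (s, t)) {0..1}"
  have g: "?g s \<in> dipaths M p q" if "s \<in> {0..1}" for s
    using is_dipath_restrict h(4) that by blast
  let ?B = "{{f \<in> extensional (topspace (top_of_set {0..1})).
      continuous_map (top_of_set {0..1}) (top_of_set M) f \<and> f ` C \<subseteq> U} | C U.
      compactin (top_of_set {0..1::real}) C \<and> openin (top_of_set M) U}"
  have "continuous_map (top_of_set {0..1})
      (compact_open_topology (top_of_set {0..1}) (top_of_set M)) ?g"
    unfolding compact_open_topology_def
  proof (rule continuous_on_generated_topo)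
    fix N assume "N \<in> ?B"
    then obtain C U where N: "N = {f \<in> extensional {0..1}.
        continuous_map (top_of_set {0..1}) (top_of_set M) f \<and> f ` C \<subseteq> U}"
      and C: "compact C" "C \<subseteq> {0..1}" and "openin (top_of_set M) U"
      by (auto simp: compactin_subtopology)
    then obtain V where V: "open V" "U = M \<inter> V"
      by (auto simp: openin_open)
    \<comment> \<open>The parameters \<open>s\<close> whose slice leaves \<open>V\<close> somewhere
      on \<open>C\<close> form the projection of this compact set, so they are closed; this is the
      tube lemma.\<close>
    let ?S = "({0..1} \<times> C) \<inter> h -` (- V)"
    have "continuous_on ({0..1} \<times> C) h"
      using C by (auto intro: continuous_on_subset[OF h(1)])
    then have "closedin (top_of_set ({0..1} \<times> C)) ?S"
      using V(1) by (intro continuous_closedin_preimage) auto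
    then have "compact ?S"
      using closedin_compact[OF compact_Times[OF compact_Icc C(1)]] by blast
    then have "compact (fst ` ?S)"
      by (intro compact_continuous_image continuous_intros)
    then have "open (- (fst ` ?S))"
      by (simp add: compact_imp_closed open_Compl)
    then have "openin (top_of_set {0..1}) ({0..1} - fst ` ?S)"
      unfolding Diff_eq by (rule openin_open_Int)
    moreover have "?g -` N \<inter> topspace (top_of_set {0..1}) = {0..1} - fst ` ?S"
    proof -
      have "?g s \<in> N \<longleftrightarrow> s \<notin> fst ` ?S" if s: "s \<in> {0..1}" for s
      proof -
        have "h (s, t) \<in> M" if "t \<in> C" for t
          using is_dipath_in[OF h(4)[rule_format, OF s], of t] that C(2) by blast
        moreover have "?g s \<in> N \<longleftrightarrow> (\<forall>t\<in>C. h (s, t) \<in> U)"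
        proof -
          have "?g s ` C = (\<lambda>t. h (s, t)) ` C"
            using C(2) by (intro image_cong) auto
          moreover have "?g s \<in> extensional {0..1}"
            "continuous_map (top_of_set {0..1}) (top_of_set M) (?g s)"
            using g[OF s] unfolding dipaths_def by simp_all
          ultimately show ?thesis
            unfolding N mem_Collect_eq by (simp only: simp_thms image_subset_iff)
        qed
        ultimately show ?thesis
          using s by (force simp: V(2))
      qed
      then show ?thesis
        by (intro set_eqI)
          (simp only: topspace_euclidean_subtopology vimage_eq Int_iff Diff_iff, metis)
    qed
    ultimately show "openin (top_of_set {0..1}) (?g -` N \<inter> topspace (top_of_set {0..1}))"
      by simp
  next
    have "?g s \<in> topspace (compact_open_topology (top_of_set {0..1}) (top_of_set M))"
      if "s \<in> {0..1}" for s
      using g[OF that] topspace_dipath_space[of M p q] by (auto simp: dipath_space_def)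
    then show "?g ` topspace (top_of_set {0..1}) \<subseteq>
      \<Union>?B"
      unfolding compact_open_topology_def topology_generated_by_topspace
        topspace_euclidean_subtopology
      by (rule image_subsetI)
  qed
  then have "pathin (dipath_space M p q) ?g"
    using g unfolding pathin_def dipath_space_def
    by (simp add: continuous_map_in_subtopology image_subset_iff)
  moreover have "?g 0 = \<gamma>" "?g 1 = \<delta>"
    using h(2,3) \<gamma> \<delta> by (auto simp: dipaths_iff extensional_def restrict_def)
  ultimately show "\<exists>g. pathin (dipath_space M p q) g \<and> g 0 = \<gamma> \<and> g 1 = \<delta>"
    by blast
qed

section \<open>Directed cubical sets\<close>

lemma push_down_real:
  fixes p :: real
  shows "\<exists>f::real \<Rightarrow> real. continuous_on UNIV f \<and> mono f \<and>
    (\<forall>y. of_int \<lfloor>y\<rfloor> \<le> f y \<and> f y \<le> of_int \<lceil>y\<rceil>) \<and> f p = of_int \<lfloor>p\<rfloor>"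
proof -
  let ?m = "real_of_int \<lfloor>p\<rfloor>"
  define c where "c = p - ?m"
  have c: "0 \<le> c" "c < 1"
    unfolding c_def by linarith+
  \<comment> \<open>Zero on \<open>[0, c]\<close>, linear from 0 to 1 on \<open>[c, 1]\<close>, the
    identity elsewhere: the part of the unit interval below \<open>p\<close> is crushed to its lower
    end and the rest is stretched.\<close>
  define g where "g z = min z (max 0 ((z - c) / (1 - c)))" for z
  define f where "f y = ?m + g (y - ?m)" for y
  have "continuous_on UNIV f"
    unfolding f_def g_def using c by (intro continuous_intros) auto
  moreover have "mono f"
    unfolding f_def g_def using c
    by (intro monoI add_left_mono min.mono max.mono divide_right_mono) auto
  moreover have "of_int \<lfloor>y\<rfloor> \<le> f y \<and> f y \<le> of_int \<lceil>y\<rceil>" for y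
  proof -
    consider "y \<le> ?m" | "?m \<le> y" "y < ?m + 1" | "?m + 1 \<le> y"
      by linarith
    then show ?thesis
    proof cases
      case 1
      then have "f y = y"
        by (auto simp: f_def g_def)
      then show ?thesis by simp
    next
      case 2
      then have "\<lfloor>y\<rfloor> = \<lfloor>p\<rfloor>" by linarith
      moreover have "?m \<le> f y" "f y \<le> y"
        using 2 by (auto simp: f_def g_def)
      ultimately show ?thesis
        using le_of_int_ceiling[of y] by (metis order_trans)
    next
      case 3
      have "(y - ?m) * (1 - c) \<le> y - ?m - c"
        using 3 c mult_right_mono[of 1 "y - ?m" c] by (simp add: algebra_simps)
      then have "y - ?m \<le> (y - ?m - c) / (1 - c)"
        using c by (simp add: pos_le_divide_eq)
      then have "f y = y"
        by (auto simp: f_def g_def)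
      then show ?thesis by simp
    qed
  qed
  moreover have "f p = ?m"
    using c by (simp add: f_def g_def c_def[symmetric])
  ultimately show ?thesis
    by blast
qed

text \<open>Negation exchanges floor and ceiling.\<close>

lemma push_up_real:
  fixes p :: real
  shows "\<exists>f::real \<Rightarrow> real. continuous_on UNIV f \<and> mono f \<and>
    (\<forall>y. of_int \<lfloor>y\<rfloor> \<le> f y \<and> f y \<le> of_int \<lceil>y\<rceil>) \<and> f p = of_int \<lceil>p\<rceil>"
proof -
  obtain f :: "real \<Rightarrow> real" where f: "continuous_on UNIV f" "mono f"
    "\<And>y. of_int \<lfloor>y\<rfloor> \<le> f y \<and> f y \<le> of_int \<lceil>y\<rceil>"
    "f (- p) = of_int \<lfloor>- p\<rfloor>"
    using push_down_real[of "- p"] by blast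
  have "continuous_on UNIV (\<lambda>y. - f (- y))"
    by (rule continuous_on_minus, rule continuous_on_compose2[OF f(1)])
      (auto intro!: continuous_intros)
  moreover have "mono (\<lambda>y. - f (- y))"
    using monoD[OF f(2)] by (intro monoI) simp
  moreover have "of_int \<lfloor>y\<rfloor> \<le> - f (- y) \<and> - f (- y) \<le> of_int \<lceil>y\<rceil>" for y
    using f(3)[of "- y"] by (simp add: ceiling_minus floor_minus)
  moreover have "- f (- p) = of_int \<lceil>p\<rceil>"
    using f(4) by (simp add: floor_minus)
  ultimately show ?thesis
    by blast
qed

text \<open>\<open>S\<close> selects the coordinates in which \<open>p\<close> is pushed down; in
  the others it is pushed up. Acting on each coordinate separately keeps the map monotone for the
  product order.\<close>

lemma push_map:
  fixes p :: "real ^ 'n"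
  obtains h where "continuous_on UNIV h" "mono h" "\<And>x. h x \<in> carrier x"
    "\<And>i. i \<in> S \<Longrightarrow> h p $ i = of_int \<lfloor>p $ i\<rfloor>" "\<And>i. i \<notin> S \<Longrightarrow> h p $ i = of_int \<lceil>p $ i\<rceil>"
proof -
  have "\<exists>f::real \<Rightarrow> real. continuous_on UNIV f \<and> mono f \<and> (\<forall>y. of_int \<lfloor>y\<rfloor> \<le> f y \<and> f y \<le> of_int \<lceil>y\<rceil>) \<and>
      f (p $ i) = of_int (if i \<in> S then \<lfloor>p $ i\<rfloor> else \<lceil>p $ i\<rceil>)" for i
    using push_down_real[of "p $ i"] push_up_real[of "p $ i"] by simp
  then obtain f :: "'n \<Rightarrow> real \<Rightarrow> real" where f: "\<And>i. continuous_on UNIV (f i)" "\<And>i. mono (f i)"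
    "\<And>i y. of_int \<lfloor>y\<rfloor> \<le> f i y \<and> f i y \<le> of_int \<lceil>y\<rceil>"
    "\<And>i. f i (p $ i) = of_int (if i \<in> S then \<lfloor>p $ i\<rfloor> else \<lceil>p $ i\<rceil>)"
    by metis
  let ?h = "\<lambda>x::real ^ 'n. \<chi> i. f i (x $ i)"
  show thesis
  proof (rule that[of ?h])
    show "continuous_on UNIV ?h"
      by (rule continuous_on_vec_lambda, rule continuous_on_compose2[OF f(1)])
        (auto intro!: continuous_intros)
    show "mono ?h"
      using f(2) by (auto intro!: monoI simp: less_eq_vec_def monoD)
    show "?h x \<in> carrier x" for x
      using f(3) by (simp add: carrier_def)
  qed (use f(4) in simp_all)
qed

text \<open>Common frame for the reachable complex and its collapse. Closure under carriers
  expresses that \<open>M\<close> is a union of elementary cubes.\<close>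

locale directed_cubical_set =
  fixes M :: "(real ^ 'n) set" and w :: "real ^ 'n"
  assumes carrier_subset: "x \<in> M \<Longrightarrow> carrier x \<subseteq> M"
    and w_lattice: "w \<in> lattice_points"
    and w_le: "x \<in> M \<Longrightarrow> w \<le> x"
begin

lemma push_dipath:
  assumes \<gamma>: "is_dipath M w q \<gamma>"
    and h: "continuous_on UNIV h" "mono h" "\<And>x. h x \<in> carrier x"
  shows "is_dipath M w (h q) (h \<circ> \<gamma>)"
proof -
  have "h ` M \<subseteq> M"
    using h(3) carrier_subset by blast
  moreover have "h w = w"
    using h(3)[of w] carrier_lattice_point[OF w_lattice] by simp
  ultimately show ?thesis
    using is_dipath_compose[OF \<gamma> h(1,2)] by metis
qed

text \<open>Each point moves within its carrier, which is convex and contained in \<open>M\<close>.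
  The ends are lattice points, whose carriers are single points, so they stay fixed.\<close>

lemma push_dihomotopic:
  assumes \<gamma>: "is_dipath M w v \<gamma>" and v: "v \<in> lattice_points"
    and h: "continuous_on UNIV h" "mono h" "\<And>x. h x \<in> carrier x"
  shows "is_dipath M w v (h \<circ> \<gamma>)" "dihomotopic M w v \<gamma> (h \<circ> \<gamma>)"
proof -
  have "h v = v"
    using h(3)[of v] carrier_lattice_point[OF v] by simp
  then show "is_dipath M w v (h \<circ> \<gamma>)"
    using push_dipath[OF \<gamma> h] by simp
  then show "dihomotopic M w v \<gamma> (h \<circ> \<gamma>)"
  proof (rule dihomotopic_linear[OF \<gamma>])
    show "closed_segment (\<gamma> t) ((h \<circ> \<gamma>) t) \<subseteq> M" if "t \<in> {0..1}" for t
      using closed_segment_subset_carrier[OF h(3)] carrier_subset[OF is_dipath_in[OF \<gamma> that]] by force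
  qed
qed

section \<open>How dipaths arrive at a vertex\<close>

lemma dipath_near_end:
  assumes \<gamma>: "is_dipath M w v \<gamma>" and "w \<noteq> v"
  shows "\<exists>t\<in>{0..1}. \<gamma> t \<noteq> v \<and> (\<forall>i. v $ i - 1 < \<gamma> t $ i)"
proof -
  let ?f = "\<lambda>t. \<Sum>i\<in>UNIV. v $ i - \<gamma> t $ i"
  have le: "\<gamma> t $ i \<le> v $ i" if "t \<in> {0..1}" for t i
    using is_dipath_between[OF \<gamma> that] by (simp add: less_eq_vec_def)
  have "continuous_on {0..1} \<gamma>"
    using \<gamma> by (simp add: is_dipath_def path_def)
  then have cont: "continuous_on {0..1} ?f"
    by (intro continuous_intros)
  have "?f 0 \<noteq> 0"
  proof
    assume "?f 0 = 0"
    then have "\<forall>i. v $ i - \<gamma> 0 $ i = 0"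
      using le[of 0] by (subst (asm) sum_nonneg_eq_0_iff) auto
    then show False
      using \<gamma> \<open>w \<noteq> v\<close> by (auto simp: is_dipath_def vec_eq_iff)
  qed
  moreover have "0 \<le> ?f 0" "?f 1 = 0"
    using \<gamma> le[of 0] by (auto simp: is_dipath_def intro: sum_nonneg)
  \<comment> \<open>The intermediate value theorem is applied to the l1 distance to
    \<open>v\<close>. The value is positive, so the point found is not \<open>v\<close>; less than
    1, so every coordinate is within 1 of \<open>v\<close>; and at most the initial distance, so it
    is attained.\<close>
  ultimately have c: "0 < min (?f 0) (1/2)" "min (?f 0) (1/2) < 1" "min (?f 0) (1/2) \<le> ?f 0"
    "?f 1 \<le> min (?f 0) (1/2)"
    by auto
  obtain t where "0 \<le> t" "t \<le> 1" "?f t = min (?f 0) (1/2)"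
    using IVT2'[OF c(4,3) zero_le_one cont] by blast
  with c have t: "t \<in> {0..1}" "0 < ?f t" "?f t < 1"
    by simp_all
  have "v $ i - \<gamma> t $ i \<le> ?f t" for i
    using le[OF t(1)] by (intro member_le_sum[where f = "\<lambda>i. v $ i - \<gamma> t $ i"]) auto
  then have "v $ i - 1 < \<gamma> t $ i" for i
    using t(3) by (smt (verit))
  moreover have "\<gamma> t \<noteq> v"
    using t(2) by auto
  ultimately show ?thesis
    using t(1) by blast
qed

text \<open>The link between dipaths and past links: the position of a dipath shortly before
  \<open>v\<close> selects a simplex, because the carrier of that point is a cube ending at
  \<open>v\<close>.\<close>

lemma support_in_past_link:
  assumes "v \<in> lattice_points" "x \<in> M" "x \<le> v" "x \<noteq> v" "\<And>i. v $ i - 1 < x $ i"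
  shows "{i. x $ i \<noteq> v $ i} \<in> past_link M v"
  using carrier_near_lattice_point[OF assms(1,5,3)] carrier_subset[OF assms(2)] assms(4)
  by (auto simp: past_link_iff vec_eq_iff)

lemma past_link_edge:
  assumes "v \<in> lattice_points" "{i} \<in> past_link M v"
  shows "v - axis i 1 \<in> verts M" "{v - axis i 1..v} \<subseteq> M" "v - axis i 1 \<le> v" "v \<in> M"
    "is_dipath M (v - axis i 1) v (linepath (v - axis i 1) v)"
proof -
  show le: "v - axis i 1 \<le> v"
    by (simp add: less_eq_vec_def axis_def)
  show sub: "{v - axis i 1..v} \<subseteq> M"
    using assms(2) by (simp add: past_link_iff simplex_vec_singleton)
  then show "v \<in> M" "is_dipath M (v - axis i 1) v (linepath (v - axis i 1) v)"
    using le by (auto intro: is_dipath_linepath)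
  have "v - axis i 1 \<in> lattice_points"
    using assms(1) by (auto simp: lattice_points_def axis_def)
  then show "v - axis i 1 \<in> verts M"
    using sub le by (auto simp: verts_def)
qed

lemma past_link_nonempty_edge:
  assumes "past_link M v \<noteq> {}"
  obtains i where "{i} \<in> past_link M v"
proof -
  obtain S where S: "S \<in> past_link M v"
    using assms by blast
  then obtain i where "i \<in> S"
    by (auto simp: past_link_iff)
  then show thesis
    using that past_link_subset[OF S, of "{i}"] by simp
qed

lemma past_link_nonempty:
  assumes "is_dipath M w v \<gamma>" "v \<in> lattice_points" "w \<noteq> v"
  shows "past_link M v \<noteq> {}"
proof -
  obtain t where "t \<in> {0..1}" "\<gamma> t \<noteq> v" "\<And>i. v $ i - 1 < \<gamma> t $ i"
    using dipath_near_end[OF assms(1,3)] by blast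
  then have "{i. \<gamma> t $ i \<noteq> v $ i} \<in> past_link M v"
    using assms by (intro support_in_past_link) (auto intro: is_dipath_in dest: is_dipath_between)
  then show ?thesis by blast
qed

text \<open>Induction on the l1 distance to \<open>w\<close>, which drops by 1 with each step back
  along an edge.\<close>

lemma verts_induct [consumes 1, case_names step]:
  assumes "v \<in> verts M"
    and step: "\<And>v. v \<in> verts M \<Longrightarrow> (\<And>i. v - axis i 1 \<in> verts M \<Longrightarrow> P (v - axis i 1)) \<Longrightarrow> P v"
  shows "P v"
  using assms(1)
proof (induction v rule: measure_induct_rule[where f = "\<lambda>v. nat \<lfloor>\<Sum>i\<in>UNIV. v $ i - w $ i\<rfloor>"])
  case (less v)
  show ?case
  proof (rule step[OF less.prems])
    fix i assume u: "v - axis i 1 \<in> verts M"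
    let ?f = "\<lambda>v. \<Sum>i\<in>UNIV. v $ i - w $ i"
    have "0 \<le> ?f (v - axis i 1)"
      using w_le[of "v - axis i 1"] u by (intro sum_nonneg) (auto simp: verts_def less_eq_vec_def)
    moreover have "?f (v - axis i 1) = ?f v - 1"
      by (simp add: sum_subtractf axis_def)
    ultimately have "nat \<lfloor>?f (v - axis i 1)\<rfloor> < nat \<lfloor>?f v\<rfloor>"
      by linarith
    then show "P (v - axis i 1)"
      using less.IH u by blast
  qed
qed

text \<open>A dipath to the lower end of an edge extends along that edge. For a collapse, this is
  where dipaths to the vertices come from.\<close>

lemma reachable_if_past_links_nonempty:
  assumes "\<And>v. v \<in> verts M \<Longrightarrow> v \<noteq> w \<Longrightarrow> past_link M v \<noteq> {}" and "v \<in> verts M"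
  shows "\<exists>\<gamma>. is_dipath M w v \<gamma>"
  using assms(2)
proof (induction rule: verts_induct)
  case (step v)
  show ?case
  proof (cases "v = w")
    case True
    then show ?thesis
      using step.hyps is_dipath_linepath[of w w M] by (auto simp: verts_def)
  next
    case False
    then obtain i where i: "{i} \<in> past_link M v"
      using assms(1) step.hyps past_link_nonempty_edge by metis
    have v: "v \<in> lattice_points"
      using step.hyps by (simp add: verts_def)
    show ?thesis
      using step.IH[OF past_link_edge(1)[OF v i]] is_dipath_join past_link_edge(5)[OF v i] by blast
  qed
qed

text \<open>Reparametrize so that \<open>u\<close> is met at time 1/2. From then on the dipath stays
  between \<open>u\<close> and \<open>v\<close> by monotonicity, and this convex box lies in
  \<open>M\<close>, so the second half can be straightened.\<close>

lemma dipath_factor: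
  assumes \<gamma>: "is_dipath M p v \<gamma>" and t: "t \<in> {0..1}" "\<gamma> t = u" and sub: "{u..v} \<subseteq> M"
  shows "\<exists>\<alpha>. is_dipath M p u \<alpha> \<and> dihomotopic M p v \<gamma> (\<alpha> +++ linepath u v)"
proof -
  have 1: "is_dipath {0..1} 0 t (linepath 0 t)" and 2: "is_dipath {0..1} t 1 (linepath t 1)"
    using t by (auto intro!: is_dipath_linepath)
  let ?\<phi> = "linepath 0 t +++ linepath t 1"
  let ?\<alpha> = "\<gamma> \<circ> linepath 0 t"
  have \<phi>: "is_dipath {0..1} 0 1 ?\<phi>"
    using is_dipath_join[OF 1 2] .
  have ends: "\<gamma> 0 = p" "\<gamma> 1 = v"
    using \<gamma> by (auto simp: is_dipath_def)
  have \<alpha>: "is_dipath M p u ?\<alpha>"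
    using is_dipath_reparam[OF \<gamma> 1] ends t by simp
  have uv: "u \<le> v"
    using is_dipath_between[OF \<gamma> t(1)] t(2) by simp
  have line: "is_dipath {u..v} u v (linepath u v)"
    using uv by (intro is_dipath_linepath) auto
  have g2: "is_dipath M p v (\<gamma> \<circ> ?\<phi>)"
    using is_dipath_reparam[OF \<gamma> \<phi>] ends by simp
  have g3: "is_dipath M p v (?\<alpha> +++ linepath u v)"
    using is_dipath_join[OF \<alpha> is_dipath_subset[OF line]] is_dipath_in[OF line] sub by blast
  have "dihomotopic M p v \<gamma> (\<gamma> \<circ> ?\<phi>)"
    by (rule dihomotopic_reparam[OF \<gamma> \<phi>])
  also have "dihomotopic M p v (\<gamma> \<circ> ?\<phi>) (?\<alpha> +++ linepath u v)"
  proof (rule dihomotopic_linear[OF g2 g3])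
    fix s :: real assume s: "s \<in> {0..1}"
    show "closed_segment ((\<gamma> \<circ> ?\<phi>) s) ((?\<alpha> +++ linepath u v) s) \<subseteq> M"
    proof (cases "s \<le> 1/2")
      case True
      then have "(\<gamma> \<circ> ?\<phi>) s = (?\<alpha> +++ linepath u v) s"
        by (simp add: joinpaths_def)
      then show ?thesis
        using is_dipath_in[OF g2 s] by simp
    next
      case False
      then have "(?\<alpha> +++ linepath u v) s \<in> {u..v}"
        using is_dipath_in[OF line, of "2 * s - 1"] s by (simp add: joinpaths_def)
      moreover have "t \<le> ?\<phi> s" "?\<phi> s \<le> 1"
        using False is_dipath_between[OF 2, of "2 * s - 1"] s by (auto simp: joinpaths_def)
      then have "(\<gamma> \<circ> ?\<phi>) s \<in> {u..v}"
        using is_dipath_mono[OF \<gamma>, of t "?\<phi> s"] is_dipath_between[OF \<gamma>, of "?\<phi> s"] t by auto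
      ultimately have "closed_segment ((\<gamma> \<circ> ?\<phi>) s) ((?\<alpha> +++ linepath u v) s) \<subseteq> {u..v}"
        using convex_box(1)[of u v] by (intro closed_segment_subset) (simp_all only: interval_cbox)
      then show ?thesis
        using sub by blast
    qed
  qed
  finally show ?thesis
    using \<alpha> by blast
qed

text \<open>Pushing the point of the dipath near \<open>v\<close> down in one coordinate and up in the others makes the
  dipath pass through a neighbour of \<open>v\<close>.\<close>

lemma dipath_through_edge:
  assumes \<gamma>: "is_dipath M w v \<gamma>" and v: "v \<in> lattice_points" "w \<noteq> v"
  obtains i \<alpha> where "{i} \<in> past_link M v" "is_dipath M w (v - axis i 1) \<alpha>"
    "dihomotopic M w v \<gamma> (\<alpha> +++ linepath (v - axis i 1) v)"
proof -
  obtain t where t: "t \<in> {0..1}" "\<gamma> t \<noteq> v" and near: "\<And>i. v $ i - 1 < \<gamma> t $ i"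
    using dipath_near_end[OF \<gamma> v(2)] by blast
  have le: "\<gamma> t \<le> v"
    using is_dipath_between[OF \<gamma> t(1)] by simp
  obtain i where i: "\<gamma> t $ i \<noteq> v $ i"
    using t(2) by (auto simp: vec_eq_iff)
  have "{k. \<gamma> t $ k \<noteq> v $ k} \<in> past_link M v"
    using support_in_past_link[OF v(1) is_dipath_in[OF \<gamma> t(1)] le t(2) near] .
  then have link: "{i} \<in> past_link M v"
    by (rule past_link_subset) (use i in auto)
  obtain h where h: "continuous_on UNIV h" "mono h" "\<And>x. h x \<in> carrier x"
    and hi: "\<And>k. k \<in> {i} \<Longrightarrow> h (\<gamma> t) $ k = of_int \<lfloor>\<gamma> t $ k\<rfloor>"
      "\<And>k. k \<notin> {i} \<Longrightarrow> h (\<gamma> t) $ k = of_int \<lceil>\<gamma> t $ k\<rceil>"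
    using push_map[of "{i}" "\<gamma> t"] by blast
  have "h (\<gamma> t) $ k = (v - axis i 1) $ k" for k
    using hi[of k] floor_ceiling_near_lattice_point[OF v(1) near, of k] le i
    by (cases "k = i") (auto simp: less_eq_vec_def axis_def)
  then have "(h \<circ> \<gamma>) t = v - axis i 1"
    by (simp add: vec_eq_iff)
  from dipath_factor[OF push_dihomotopic(1)[OF \<gamma> v(1) h] t(1) this past_link_edge(2)[OF v(1) link]]
  obtain \<alpha> where \<alpha>: "is_dipath M w (v - axis i 1) \<alpha>"
    "dihomotopic M w v (h \<circ> \<gamma>) (\<alpha> +++ linepath (v - axis i 1) v)"
    by blast
  from dihomotopic_trans[OF push_dihomotopic(2)[OF \<gamma> v(1) h] \<alpha>(2)]
  show thesis
    by (rule that[OF link \<alpha>(1)])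
qed

text \<open>Both dipaths follow a common \<open>\<delta>\<close> to the corner of the square
  opposite \<open>v\<close> and then go around it on different sides; the convex box of the square
  contains both tails.\<close>

lemma dihomotopic_across_square:
  assumes v: "v \<in> lattice_points" and jk: "{j, k} \<in> past_link M v" "j \<noteq> k"
    and reach: "\<And>v. v \<in> verts M \<Longrightarrow> \<exists>\<gamma>. is_dipath M w v \<gamma>"
  obtains \<alpha> \<beta> where "is_dipath M w (v - axis j 1) \<alpha>" "is_dipath M w (v - axis k 1) \<beta>"
    "dihomotopic M w v (\<alpha> +++ linepath (v - axis j 1) v) (\<beta> +++ linepath (v - axis k 1) v)"
proof -
  define u where "u = v - axis j 1 - axis k 1"
  have "simplex_vec {j, k} = axis j 1 + axis k (1::real)"
    using jk(2) by (auto simp: simplex_vec_def vec_eq_iff axis_def)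
  then have sub: "{u..v} \<subseteq> M"
    using jk(1) by (simp add: past_link_iff u_def algebra_simps)
  have u: "u \<in> verts M"
  proof -
    have "u \<le> v"
      by (simp add: u_def less_eq_vec_def axis_def)
    moreover have "u \<in> lattice_points"
      using v by (auto simp: u_def lattice_points_def axis_def)
    ultimately show ?thesis
      using sub by (auto simp: verts_def)
  qed
  then obtain \<delta> where \<delta>: "is_dipath M w u \<delta>"
    using reach by blast
  have main: "is_dipath M w (v - axis i 1) (\<delta> +++ linepath u (v - axis i 1))"
    "is_dipath M w v ((\<delta> +++ linepath u (v - axis i 1)) +++ linepath (v - axis i 1) v)"
    if "i \<in> {j, k}" for i
  proof -
    have le: "u \<le> v - axis i 1" "v - axis i 1 \<le> v"
      using that by (auto simp: u_def less_eq_vec_def axis_def)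
    have "is_dipath M u (v - axis i 1) (linepath u (v - axis i 1))"
      "is_dipath M (v - axis i 1) v (linepath (v - axis i 1) v)"
      using le sub by (auto intro!: is_dipath_linepath order_trans[OF _ sub]
          intro: order_trans[OF _ le(2)] order_trans[OF le(1)])
    then show "is_dipath M w (v - axis i 1) (\<delta> +++ linepath u (v - axis i 1))"
      "is_dipath M w v ((\<delta> +++ linepath u (v - axis i 1)) +++ linepath (v - axis i 1) v)"
      using \<delta> by (blast intro: is_dipath_join)+
  qed
  let ?\<Gamma> = "\<lambda>i. (\<delta> +++ linepath u (v - axis i 1)) +++ linepath (v - axis i 1) v"
  have \<Gamma>: "is_dipath M w v (?\<Gamma> i)" if "i \<in> {j, k}" for i
    using main(2)[OF that] .
  have "dihomotopic M w v (?\<Gamma> j) (?\<Gamma> k)"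
  proof (rule dihomotopic_linear)
    fix t :: real assume t: "t \<in> {0..1}"
    show "closed_segment (?\<Gamma> j t) (?\<Gamma> k t) \<subseteq> M"
    \<comment> \<open>The two nested joins run through \<open>\<delta>\<close> during the first
      quarter.\<close>
    proof (cases "t \<le> 1/4")
      case True
      then have "?\<Gamma> j t = ?\<Gamma> k t"
        by (simp add: joinpaths_def)
      then show ?thesis
        using is_dipath_in[OF \<Gamma> t, of j] by simp
    next
      case False
      have "?\<Gamma> i t \<in> {u..v}" if i: "i \<in> {j, k}" for i
      proof -
        have "?\<Gamma> i (1/4) = u"
          using \<delta> by (simp add: joinpaths_def is_dipath_def)
        then show ?thesis
          using is_dipath_mono[OF \<Gamma>[OF i], of "1/4" t] is_dipath_between[OF \<Gamma>[OF i] t] False t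
          by simp
      qed
      then have "closed_segment (?\<Gamma> j t) (?\<Gamma> k t) \<subseteq> {u..v}"
        using convex_box(1)[of u v]
        by (intro closed_segment_subset) (simp_all add: interval_cbox del: mem_box_cart)
      then show ?thesis
        using sub by blast
    qed
  qed (use \<Gamma> in auto)
  then show thesis
    using that main(1) by blast
qed

lemma dihomotopic_if_links_indecomposable:
  assumes nonempty: "\<And>v. v \<in> verts M \<Longrightarrow> v \<noteq> w \<Longrightarrow> past_link M v \<noteq> {}"
    and indec: "\<And>v. v \<in> verts M \<Longrightarrow> v \<noteq> w \<Longrightarrow> link_indecomposable (past_link M v)"
    and "v \<in> verts M" "is_dipath M w v \<gamma>" "is_dipath M w v \<delta>"
  shows "dihomotopic M w v \<gamma> \<delta>"
  using assms(3-)
proof (induction arbitrary: \<gamma> \<delta> rule: verts_induct)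
  case (step v)
  note \<gamma> = step.prems(1) and \<delta> = step.prems(2)
  have v: "v \<in> lattice_points"
    using step.hyps by (simp add: verts_def)
  show ?case
  proof (cases "v = w")
    case True
    have "\<gamma> t = w" "\<delta> t = w" if "t \<in> {0..1}" for t
      using is_dipath_between[OF \<gamma> that] is_dipath_between[OF \<delta> that] True by auto
    then show ?thesis
      using step.hyps True by (intro dihomotopic_linear[OF \<gamma> \<delta>]) (auto simp: verts_def)
  next
    case False
    let ?D = "\<lambda>i \<alpha>. \<alpha> +++ linepath (v - axis i 1) v"
    have D: "dihomotopic M w v (?D i \<alpha>) (?D i \<beta>)"
      if "{i} \<in> past_link M v" "is_dipath M w (v - axis i 1) \<alpha>"
        "is_dipath M w (v - axis i 1) \<beta>" for i \<alpha> \<beta>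
      using step.IH[OF past_link_edge(1)[OF v that(1)] that(2,3)] past_link_edge(5)[OF v that(1)]
      by (rule dihomotopic_join_left)
    \<comment> \<open>Quantifying over all \<open>\<alpha>\<close> makes membership a property of
      the edge alone; for an edge of the link, \<open>D\<close> shows that one suitable
      \<open>\<alpha>\<close> suffices. Squares carry membership between vertices of a common
      simplex, so no simplex straddles \<open>A\<close>.\<close>
    define A where "A = {i. \<forall>\<alpha>. is_dipath M w (v - axis i 1) \<alpha> \<longrightarrow> dihomotopic M w v \<gamma> (?D i \<alpha>)}"
    have "S \<subseteq> A" if S: "S \<in> past_link M v" and "S \<inter> A \<noteq> {}" for S
    proof
      fix k assume k: "k \<in> S"
      obtain j where j: "j \<in> S" "j \<in> A"
        using \<open>S \<inter> A \<noteq> {}\<close> by blast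
      show "k \<in> A"
      proof (cases "j = k")
        case False
        have jk: "{j, k} \<in> past_link M v" "{k} \<in> past_link M v"
          using past_link_subset[OF S] j(1) k by auto
        obtain \<alpha> \<beta> where \<alpha>\<beta>: "is_dipath M w (v - axis j 1) \<alpha>" "is_dipath M w (v - axis k 1) \<beta>"
          "dihomotopic M w v (?D j \<alpha>) (?D k \<beta>)"
          using dihomotopic_across_square[OF v jk(1) False]
            reachable_if_past_links_nonempty[OF nonempty] by blast
        have "dihomotopic M w v \<gamma> (?D k \<beta>)"
          using j(2) \<alpha>\<beta> dihomotopic_trans unfolding A_def by blast
        then show ?thesis
          using D[OF jk(2) \<alpha>\<beta>(2)] dihomotopic_trans unfolding A_def by blast
      qed (use j in simp)
    qed
    then have split: "\<forall>S\<in>past_link M v. S \<subseteq> A \<or> S \<inter> A = {}"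
      by blast
    obtain i \<alpha> where i: "{i} \<in> past_link M v" "is_dipath M w (v - axis i 1) \<alpha>"
      "dihomotopic M w v \<gamma> (?D i \<alpha>)"
      using dipath_through_edge[OF \<gamma> v] False by metis
    obtain k \<beta> where k: "{k} \<in> past_link M v" "is_dipath M w (v - axis k 1) \<beta>"
      "dihomotopic M w v \<delta> (?D k \<beta>)"
      using dipath_through_edge[OF \<delta> v] False by metis
    have "i \<in> A"
      using D[OF i(1,2)] i(3) dihomotopic_trans unfolding A_def by blast
    \<comment> \<open>\<open>A\<close> contains the edge through which \<open>\<gamma>\<close>
      arrives, so indecomposability forces it to contain the one through which
      \<open>\<delta>\<close> arrives.\<close>
    then have "k \<in> A"
      using indec[OF step.hyps False] split i(1) k(1) unfolding link_indecomposable_def by blast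
    then have "dihomotopic M w v \<gamma> (?D k \<beta>)"
      using k(2) by (simp add: A_def)
    then show ?thesis
      using k(3) dihomotopic_sym dihomotopic_trans by blast
  qed
qed

text \<open>Dipaths to \<open>v\<close> are separated by the part of a decomposed past link through which they arrive.\<close>

lemma link_indecomposable_if_connected:
  assumes v: "v \<in> verts M" and reach: "\<And>v. v \<in> verts M \<Longrightarrow> \<exists>\<gamma>. is_dipath M w v \<gamma>"
    and conn: "connected_space (dipath_space M w v)"
  shows "link_indecomposable (past_link M v)"
  unfolding link_indecomposable_def
proof (intro allI impI, rule ccontr)
  fix A assume split: "\<forall>S\<in>past_link M v. S \<subseteq> A \<or> S \<inter> A = {}"
    and "\<not> ((\<forall>S\<in>past_link M v. S \<subseteq> A) \<or> (\<forall>S\<in>past_link M v. S \<inter> A = {}))"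
  then obtain S T i k where ST:
    "S \<in> past_link M v" "T \<in> past_link M v" "i \<in> S" "i \<notin> A" "k \<in> T" "k \<in> A"
    by blast
  then have link: "{i} \<in> past_link M v" "{k} \<in> past_link M v"
    using past_link_subset[of S M v "{i}"] past_link_subset[of T M v "{k}"] by auto
  have lat: "v \<in> lattice_points"
    using v by (simp add: verts_def)
  \<comment> \<open>An edge ending at \<open>w\<close> would start at a point of \<open>M\<close>
    that is not above \<open>w\<close>.\<close>
  have "w \<noteq> v"
  proof
    assume "w = v"
    then have "w \<le> w - axis i 1"
      using past_link_edge(1)[OF lat link(1)] w_le by (auto simp: verts_def)
    then have "w $ i \<le> w $ i - 1"
      by (auto simp: less_eq_vec_def axis_def dest: spec[of _ i])
    then show False by simp
  qed
  \<comment> \<open>Points close to \<open>v\<close> and still below it in some coordinate from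
    \<open>B\<close>; \<open>U B\<close> collects the dipaths that visit such a point at some
    time.\<close>
  define W where "W B = {x. (\<forall>i. v $ i - 1 < x $ i) \<and> (\<exists>i\<in>B. x $ i < v $ i)}" for B
  define U where "U B = (\<Union>t\<in>{0..1}. {\<gamma> \<in> dipaths M w v. \<gamma> t \<in> W B})" for B
  have openW: "open (W B)" for B
  proof -
    have "W B = (\<Inter>i. {x. v $ i - 1 < x $ i}) \<inter> (\<Union>i\<in>B. {x. x $ i < v $ i})"
      by (auto simp: W_def)
    also have "open \<dots>"
      by (intro open_Int open_INT open_UN ballI open_Collect_less continuous_intros) auto
    finally show ?thesis .
  qed
  have "openin (dipath_space M w v) (U B)" for B
    unfolding U_def by (intro openin_Union) (auto intro: openin_dipath_space_eval openW)
  moreover have "topspace (dipath_space M w v) \<subseteq> U A \<union> U (- A)"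
  proof
    fix \<gamma> assume "\<gamma> \<in> topspace (dipath_space M w v)"
    then have \<gamma>: "\<gamma> \<in> dipaths M w v" "is_dipath M w v \<gamma>"
      by (auto simp: topspace_dipath_space dipaths_iff)
    obtain t where t: "t \<in> {0..1}" "\<gamma> t \<noteq> v" "\<forall>i. v $ i - 1 < \<gamma> t $ i"
      using dipath_near_end[OF \<gamma>(2) \<open>w \<noteq> v\<close>] by blast
    moreover have "\<gamma> t \<le> v"
      using is_dipath_between[OF \<gamma>(2) t(1)] by simp
    ultimately obtain m where "\<gamma> t $ m < v $ m"
      by (auto simp: vec_eq_iff less_eq_vec_def order_less_le)
    then have "\<gamma> t \<in> W A \<union> W (- A)"
      using t(3) by (auto simp: W_def)
    then show "\<gamma> \<in> U A \<union> U (- A)"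
      using t(1) \<gamma>(1) by (auto simp: U_def)
  qed
  moreover have "U A \<inter> U (- A) = {}"
  proof (rule ccontr)
    assume "U A \<inter> U (- A) \<noteq> {}"
    then obtain \<gamma> s t where "\<gamma> \<in> dipaths M w v" and s: "s \<in> {0..1}" "\<gamma> s \<in> W A"
      and t: "t \<in> {0..1}" "\<gamma> t \<in> W (- A)"
      unfolding U_def by blast
    then have \<gamma>: "is_dipath M w v \<gamma>"
      by (simp add: dipaths_iff)
    \<comment> \<open>At the earlier of the two times, monotonicity keeps both coordinates
      \<open>a\<close> and \<open>b\<close> below those of \<open>v\<close>, so the simplex selected
      there meets \<open>A\<close> and its complement.\<close>
    let ?x = "\<gamma> (min s t)"
    have x: "min s t \<in> {0..1}" "?x \<le> \<gamma> s" "?x \<le> \<gamma> t"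
      using s(1) t(1) by (auto intro!: is_dipath_mono[OF \<gamma>] simp: min_def)
    obtain a b where ab: "a \<in> A" "\<gamma> s $ a < v $ a" "b \<notin> A" "\<gamma> t $ b < v $ b"
      using s(2) t(2) by (auto simp: W_def)
    have "?x $ a \<le> \<gamma> s $ a" "?x $ b \<le> \<gamma> t $ b"
      using x(2,3) unfolding less_eq_vec_def by blast+
    with ab have neq: "?x $ a \<noteq> v $ a" "?x $ b \<noteq> v $ b"
      by linarith+
    let ?S = "{i. ?x $ i \<noteq> v $ i}"
    have "?S \<in> past_link M v"
    proof (rule support_in_past_link[OF lat is_dipath_in[OF \<gamma> x(1)]])
      show "?x \<le> v"
        using is_dipath_between[OF \<gamma> x(1)] by simp
      show "?x \<noteq> v"
        using neq by auto
      show "v $ i - 1 < ?x $ i" for i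
        using s(2) t(2) by (auto simp: W_def min_def)
    qed
    then show False
      using bspec[OF split, of ?S] neq ab(1,3) by (auto simp: subset_iff disjoint_iff)
  qed
  moreover have "U B \<noteq> {}" if m: "{m} \<in> past_link M v" "m \<in> B" for m B
  proof -
    obtain \<alpha> where "is_dipath M w (v - axis m 1) \<alpha>"
      using reach past_link_edge(1)[OF lat m(1)] by blast
    then have "is_dipath M w v (\<alpha> +++ linepath (v - axis m 1) v)" (is "is_dipath M w v ?\<gamma>")
      using past_link_edge(5)[OF lat m(1)] by (rule is_dipath_join)
    then have "restrict ?\<gamma> {0..1} \<in> dipaths M w v"
      by (rule is_dipath_restrict)
    \<comment> \<open>At time 3/4 the joined path is at the midpoint of its final edge.\<close>
    moreover have "?\<gamma> (3/4) $ i = v $ i - (if i = m then 1/2 else 0)" for i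
      by (simp add: joinpaths_def linepath_def axis_def algebra_simps)
    then have "restrict ?\<gamma> {0..1} (3/4) \<in> W B"
      using m(2) by (auto simp: W_def)
    ultimately show ?thesis
      unfolding U_def by (auto intro!: exI[of _ "restrict ?\<gamma> {0..1}"] bexI[of _ "3/4"])
  qed
  then have "U A \<noteq> {}" "U (- A) \<noteq> {}"
    using link ST by auto
  ultimately show False
    using conn unfolding connected_space_def by blast
qed

theorem connected_iff_links_indecomposable:
  assumes nonempty: "\<And>v. v \<in> verts M \<Longrightarrow> v \<noteq> w \<Longrightarrow> past_link M v \<noteq> {}"
  shows "(\<forall>v\<in>verts M. connected_space (dipath_space M w v)) \<longleftrightarrow>
         (\<forall>v\<in>verts M. v \<noteq> w \<longrightarrow> link_indecomposable (past_link M v))"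
proof
  assume "\<forall>v\<in>verts M. connected_space (dipath_space M w v)"
  then show "\<forall>v\<in>verts M. v \<noteq> w \<longrightarrow> link_indecomposable (past_link M v)"
    using link_indecomposable_if_connected reachable_if_past_links_nonempty[OF nonempty] by blast
next
  assume ind: "\<forall>v\<in>verts M. v \<noteq> w \<longrightarrow> link_indecomposable (past_link M v)"
  show "\<forall>v\<in>verts M. connected_space (dipath_space M w v)"
  proof
    fix v assume v: "v \<in> verts M"
    show "connected_space (dipath_space M w v)"
    proof (rule connected_dipath_space)
      show "dihomotopic M w v \<gamma> \<delta>" if "is_dipath M w v \<gamma>" "is_dipath M w v \<delta>" for \<gamma> \<delta>
        by (rule dihomotopic_if_links_indecomposable[OF nonempty _ v that]) (use ind in blast)+
    qed
  qed
qed

section \<open>Collapses\<close>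

lemma carrier_in_cubes: "x \<in> M \<Longrightarrow> carrier x \<in> cubes M"
  using carrier_subset elementary_cube_carrier by (simp add: cubes_def)

text \<open>The only cube with \<open>x\<close> in its relative interior is the carrier of
  \<open>x\<close>.\<close>

lemma mem_collapse:
  "x \<in> collapse M \<tau> \<sigma> \<longleftrightarrow> x \<in> M \<and> \<not> (\<tau> \<subseteq> carrier x \<and> carrier x \<subseteq> \<sigma>)"
proof -
  have "(\<exists>c\<in>cubes M. \<tau> \<subseteq> c \<and> c \<subseteq> \<sigma> \<and> x \<in> rel_interior c) \<longleftrightarrow> \<tau> \<subseteq> carrier x \<and> carrier x \<subseteq> \<sigma>"
    if "x \<in> M"
  proof
    assume "\<exists>c\<in>cubes M. \<tau> \<subseteq> c \<and> c \<subseteq> \<sigma> \<and> x \<in> rel_interior c"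
    then obtain c where c: "c \<in> cubes M" "\<tau> \<subseteq> c" "c \<subseteq> \<sigma>" "x \<in> rel_interior c"
      by blast
    then obtain z where "c = carrier z"
      by (auto simp: cubes_def elementary_cube_iff)
    then show "\<tau> \<subseteq> carrier x \<and> carrier x \<subseteq> \<sigma>"
      using c rel_interior_carrier by blast
  next
    assume "\<tau> \<subseteq> carrier x \<and> carrier x \<subseteq> \<sigma>"
    then show "\<exists>c\<in>cubes M. \<tau> \<subseteq> c \<and> c \<subseteq> \<sigma> \<and> x \<in> rel_interior c"
      using carrier_in_cubes[OF that] rel_interior_carrier[of x x] by blast
  qed
  then show ?thesis
    unfolding collapse_def by blast
qed

text \<open>A maximal cube above \<open>c\<close> contains \<open>\<tau>\<close>, so freeness makes
  it \<open>\<sigma>\<close>.\<close>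

lemma cube_subset_free_cube:
  assumes "free_face M \<tau> \<sigma>" "c \<in> cubes M" "\<tau> \<subseteq> c"
  shows "c \<subseteq> \<sigma>"
  using exists_maximal_cube[OF assms(2)] assms(1,3) unfolding free_face_def by blast

text \<open>Cubes of \<open>M\<close> above \<open>\<tau>\<close> lie in \<open>\<sigma>\<close>
  automatically, so removal passes from a cube to its cofaces and the remaining set is closed under
  faces.\<close>

lemma directed_cubical_set_collapse:
  assumes "free_face M \<tau> \<sigma>"
  shows "directed_cubical_set (collapse M \<tau> \<sigma>) w"
proof
  fix x assume x: "x \<in> collapse M \<tau> \<sigma>"
  show "carrier x \<subseteq> collapse M \<tau> \<sigma>"
  proof
    fix y assume y: "y \<in> carrier x"
    have "\<tau> \<subseteq> carrier x" if "\<tau> \<subseteq> carrier y"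
      using that carrier_mono[OF y] by blast
    moreover have "carrier x \<subseteq> \<sigma>" if "\<tau> \<subseteq> carrier x"
      using cube_subset_free_cube[OF assms carrier_in_cubes that] x by (simp add: mem_collapse)
    moreover have "y \<in> M"
      using x y carrier_subset by (auto simp: mem_collapse)
    ultimately show "y \<in> collapse M \<tau> \<sigma>"
      using x by (auto simp: mem_collapse)
  qed
qed (use w_lattice w_le in \<open>auto simp: mem_collapse\<close>)

text \<open>The carrier of a vertex is the vertex itself, and the only nonempty set inside
  \<open>{v}\<close> is \<open>{v}\<close>.\<close>

lemma verts_collapse:
  assumes "elementary_cube \<tau>" "v \<in> verts M" "\<tau> \<noteq> {v}"
  shows "v \<in> verts (collapse M \<tau> \<sigma>)"
proof -
  have "\<tau> \<noteq> {}"
    using assms(1) by (metis elementary_cube_iff empty_iff mem_carrier)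
  then show ?thesis
    using assms(2,3) carrier_lattice_point[of v] by (auto simp: verts_def mem_collapse)
qed

text \<open>All cubes ending at a free vertex lie in one cube, so its past link is a single simplex.\<close>

lemma past_link_free_vertex:
  assumes free: "free_face M {v} \<sigma>" and v: "v \<in> lattice_points"
  shows "link_indecomposable (past_link M v)"
proof -
  obtain z where z: "\<sigma> = carrier z" and "\<sigma> \<subseteq> M"
    using free by (auto simp: free_face_def maximal_cube_def cubes_def elementary_cube_iff)
  have cube: "{v - simplex_vec S..v} \<subseteq> \<sigma>" if "S \<in> past_link M v" for S
  proof (rule cube_subset_free_cube[OF free])
    show "{v - simplex_vec S..v} \<in> cubes M"
      using that v simplex_vec_zero_one by (auto simp: cubes_def elementary_cube_def past_link_iff)
    show "{v} \<subseteq> {v - simplex_vec S..v}"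
      by (simp add: less_eq_vec_def simplex_vec_def)
  qed
  have union: "S \<union> T \<in> past_link M v" if S: "S \<in> past_link M v" and T: "T \<in> past_link M v" for S T
  proof -
    have le: "v - simplex_vec R \<le> v" for R
      by (simp add: less_eq_vec_def simplex_vec_def)
    have "vfloor z \<le> v - simplex_vec S" "vfloor z \<le> v - simplex_vec T" "v \<le> vceiling z"
      using cube[OF S] cube[OF T] le by (auto simp: z carrier_eq_interval)
    then have "vfloor z \<le> v - simplex_vec (S \<union> T)"
    proof -
      \<comment> \<open>Each coordinate of the union agrees with that of \<open>S\<close> or of
        \<open>T\<close>, so the lower corner of \<open>\<sigma>\<close> still bounds the enlarged
        cube.\<close>
      have "simplex_vec (S \<union> T) $ i \<in> {simplex_vec S $ i, simplex_vec T $ i}" for i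
        by (simp add: simplex_vec_def indicator_def)
      then show ?thesis
        using \<open>vfloor z \<le> v - simplex_vec S\<close> \<open>vfloor z \<le> v - simplex_vec T\<close>
        unfolding less_eq_vec_def by (metis insertE singletonD vector_minus_component)
    qed
    then have "{v - simplex_vec (S \<union> T)..v} \<subseteq> \<sigma>"
      using \<open>v \<le> vceiling z\<close> unfolding z carrier_eq_interval atLeastatMost_subset_iff by blast
    then show ?thesis
      using \<open>\<sigma> \<subseteq> M\<close> S by (auto simp: past_link_iff)
  qed
  \<comment> \<open>The simplex \<open>S \<union> T\<close> lies on one side of \<open>A\<close>,
    which puts the nonempty simplices \<open>S\<close> and \<open>T\<close> on the same
    side.\<close>
  have "S \<subseteq> A \<longleftrightarrow> T \<subseteq> A" if "S \<in> past_link M v" "T \<in> past_link M v"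
    "\<forall>S\<in>past_link M v. S \<subseteq> A \<or> S \<inter> A = {}" for S T A
  proof -
    have "S \<union> T \<subseteq> A \<or> (S \<union> T) \<inter> A = {}"
      using bspec[OF that(3) union[OF that(1,2)]] .
    moreover have "S \<noteq> {}" "T \<noteq> {}"
      using that by (simp_all add: past_link_iff)
    ultimately show ?thesis
      by blast
  qed
  then have "(\<forall>S\<in>past_link M v. S \<subseteq> A) \<or> (\<forall>S\<in>past_link M v. S \<inter> A = {})"
    if "\<forall>S\<in>past_link M v. S \<subseteq> A \<or> S \<inter> A = {}" for A
    using that by metis
  then show ?thesis
    unfolding link_indecomposable_def by simp
qed

end

section \<open>The reachable complex\<close>

lemma reach_iff: "q \<in> reach K p \<longleftrightarrow> (\<exists>\<gamma>. is_dipath K p q \<gamma>)"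
proof -
  have "dipaths K p q \<noteq> {} \<longleftrightarrow> (\<exists>\<gamma>. is_dipath K p q \<gamma>)"
    using is_dipath_restrict[of K p q] dipaths_iff[of _ K p q] by blast
  then show ?thesis
    using is_dipath_ends(2)[of K p q] by (auto simp: reach_def)
qed

text \<open>Initial pieces of a dipath show that every point on it is reachable.\<close>

lemma is_dipath_reach:
  assumes \<gamma>: "is_dipath K p q \<gamma>"
  shows "is_dipath (reach K p) p q \<gamma>"
proof (rule is_dipath_subset[OF \<gamma>], rule image_subsetI)
  fix t :: real assume t: "t \<in> {0..1}"
  have "is_dipath {0..1} 0 t (linepath 0 t)"
    using t by (auto intro!: is_dipath_linepath)
  then show "\<gamma> t \<in> reach K p"
    using is_dipath_reparam[OF \<gamma>] \<gamma> unfolding reach_iff is_dipath_def[of K p q] by blast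
qed

lemma directed_cubical_set_complex:
  assumes "cubical_complex K" "minimum_vertex K w"
  shows "directed_cubical_set K w"
proof
  fix x assume "x \<in> K"
  then obtain c where c: "elementary_cube c" "x \<in> c" "c \<subseteq> K"
    using assms(1) unfolding cubical_complex_def by blast
  then obtain z where "c = carrier z"
    unfolding elementary_cube_iff by blast
  then show "carrier x \<subseteq> K"
    using c carrier_mono by blast
qed (use assms(2) in \<open>auto simp: minimum_vertex_def verts_def\<close>)

text \<open>Pushing a dipath down shows that the least vertex of the carrier of a reachable point is
  reachable.\<close>

lemma (in directed_cubical_set) directed_cubical_set_reach: "directed_cubical_set (reach M w) w"
proof
  fix x assume "x \<in> reach M w"
  then obtain \<gamma> where \<gamma>: "is_dipath M w x \<gamma>"
    by (auto simp: reach_iff)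
  obtain h where h: "continuous_on UNIV h" "mono h" "\<And>x. h x \<in> carrier x"
    and hx: "\<And>i. h x $ i = of_int \<lfloor>x $ i\<rfloor>"
    using push_map[of UNIV x] by (metis UNIV_I)
  have "h x = vfloor x"
    using hx by (simp add: vfloor_def vec_eq_iff)
  then have dip: "is_dipath M w (vfloor x) (h \<circ> \<gamma>)"
    using push_dipath[OF \<gamma> h] by simp
  show "carrier x \<subseteq> reach M w"
  proof
    fix y assume y: "y \<in> carrier x"
    then have "vfloor x \<le> y" "{vfloor x..y} \<subseteq> carrier x"
      by (auto simp: carrier_eq_interval)
    then have "is_dipath M (vfloor x) y (linepath (vfloor x) y)"
      using carrier_subset[OF is_dipath_ends(2)[OF \<gamma>]] by (intro is_dipath_linepath) auto
    then show "y \<in> reach M w"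
      using is_dipath_join[OF dip] reach_iff by blast
  qed
next
  show "w \<in> lattice_points" by (rule w_lattice)
  show "w \<le> x" if "x \<in> reach M w" for x
    using that w_le by (simp add: reach_def)
qed

theorem corollary3:
  fixes K L L' \<tau> \<sigma> :: "(real ^ 'n) set" and w :: "real ^ 'n"
  assumes "cubical_complex K"
    and "minimum_vertex K w"
    and "L = reach K w"
    and "lpdc_pair L \<tau> \<sigma>"
    and "L' = collapse L \<tau> \<sigma>"
  shows "(\<forall>v\<in>verts L. connected_space (dipath_space L w v)) \<longleftrightarrow>
         (\<forall>v\<in>verts L'. connected_space (dipath_space L' w v))"
proof -
  have free: "free_face L \<tau> \<sigma>"
    and hom: "\<And>v. v \<in> verts L' \<Longrightarrow>
      geometric_realization (past_link L v) homotopy_eqv geometric_realization (past_link L' v)"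
    using assms(4,5) by (auto simp: lpdc_pair_def)
  interpret L: directed_cubical_set L w
    unfolding assms(3)
    using directed_cubical_set_complex[OF assms(1,2)]
    by (rule directed_cubical_set.directed_cubical_set_reach)
  interpret L': directed_cubical_set L' w
    unfolding assms(5) by (rule L.directed_cubical_set_collapse[OF free])
  have sub: "v \<in> verts L" if "v \<in> verts L'" for v
    using that by (auto simp: assms(5) verts_def collapse_def)
  have simplices: "{} \<notin> past_link M v" for M :: "(real ^ 'n) set" and v
    by (simp add: past_link_iff)
  have nonempty: "past_link L v \<noteq> {}" if "v \<in> verts L" "v \<noteq> w" for v
  proof -
    have "v \<in> reach K w"
      using that(1) by (simp add: assms(3) verts_def)
    then obtain \<gamma> where "is_dipath L w v \<gamma>"
      unfolding assms(3) using is_dipath_reach reach_iff by metis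
    then show ?thesis
      using L.past_link_nonempty that by (auto simp: verts_def)
  qed
  \<comment> \<open>Homotopy equivalence preserves emptiness, so the collapse creates no new vertex
    without predecessors.\<close>
  have nonempty': "past_link L' v \<noteq> {}" if "v \<in> verts L'" "v \<noteq> w" for v
  proof
    assume "past_link L' v = {}"
    then have "geometric_realization (past_link L' v) = {}"
      by (simp add: geometric_realization_def)
    then have "geometric_realization (past_link L v) = {}"
      using hom[OF that(1)] homotopy_eqv_empty1 by metis
    then show False
      using nonempty[OF sub[OF that(1)] that(2)] geometric_realization_nonempty[OF simplices]
      by blast
  qed
  have links: "link_indecomposable (past_link L v) \<longleftrightarrow> link_indecomposable (past_link L' v)"
    if "v \<in> verts L'" for v
    using homotopy_eqv_connectedness_imp hom[OF that] homotopy_equivalent_space_sym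
      connected_geometric_realization_iff[OF simplices] by metis
  \<comment> \<open>A vertex disappears only if it is \<open>\<tau>\<close> itself, and then its
    past link in \<open>L\<close> imposes no condition.\<close>
  have removed: "link_indecomposable (past_link L v)" if "v \<in> verts L" "v \<notin> verts L'" for v
  proof -
    have "\<tau> = {v}"
      using L.verts_collapse[OF _ that(1)] that(2) free by (auto simp: assms(5) free_face_def)
    then show ?thesis
      using L.past_link_free_vertex free that(1) by (simp add: verts_def)
  qed
  have "(\<forall>v\<in>verts L. connected_space (dipath_space L w v)) \<longleftrightarrow>
      (\<forall>v\<in>verts L. v \<noteq> w \<longrightarrow> link_indecomposable (past_link L v))"
    using nonempty by (rule L.connected_iff_links_indecomposable)
  also have "\<dots> \<longleftrightarrow> (\<forall>v\<in>verts L'. v \<noteq> w \<longrightarrow> link_indecomposable (past_link L' v))"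
    using links removed sub by metis
  also have "\<dots> \<longleftrightarrow> (\<forall>v\<in>verts L'. connected_space (dipath_space L' w v))"
    using nonempty' by (rule L'.connected_iff_links_indecomposable[symmetric])
  finally show ?thesis .
qed

end
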